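(* Let $R_1$ and $R_2$ be distinct maximal rectangles of a moon polyomino $\mathcal M$. Let $\psi_1$ and $\psi_2$ be maps in the set $$\left\{\mathrm{RSK}^{-1}\circ\mathrm{Pro}^P\circ\mathrm{RSK},\ \mathrm{RSK}^{-1}\circ\mathrm{Pro}^Q\circ\mathrm{RSK},\ \phi\circ\rho^{-1}\circ\phi^{-1}\right\}$$ acting on $R_1$ and $R_2$, respectively (and shifting labels outside the rectangle appropriately, as described in the context, where it is assumed that all the polyominoes arising are moon polyominoes). Then $$\psi_1\circ\psi_2=\psi_2\circ\psi_1 .$$
   Context: **Moon polyominoes.** A polyomino is a finite subset of $\mathbb Z\times\mathbb Z$; its elements are boxes. Its $i$th up-diagonal is the set of its boxes $(i,j)$ with $i$ fixed; its $j$th down-diagonal is the set of its boxes $(i,j)$ with $j$ fixed. It is convex if every up-diagonal and every down-diagonal is connected (the varying coordinate runs over an interval of integers), and intersection-free if for any $i_1,i_2$ the sets $\{j:(i_1,j)\in\mathcal M\}$ and $\{j:(i_2,j)\in\mathcal M\}$ are comparable under inclusion. A moon polyomino is a convex intersection-free polyomino. A rectangle is a set $[i_1,i_2]\times[j_1,j_2]$ (integer intervals); it is maximal in $\mathcal M$ if it is inclusion-maximal among rectangles contained in $\mathcal M$. (A moon polyomino has at most one maximal rectangle of any given dimensions.) **Toggles, RSK, rowmotion, promotion.** Let $R=[r]\times[s]$ with the product order, $[n]=\{1,\dots,n\}$; write $p\lessdot q$ for cover relations. For $p\in R$ the toggle $t_p:\mathbb R^R\to\mathbb R^R$ replaces $x_p$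 by $\min_{q\gtrdot p}x_q+\max_{q\lessdot p}x_q-x_p$ and fixes all other labels (empty $\max=0$, empty $\min=1$). The transfer map $\phi:\mathbb R^R\to\mathbb R^R$ is the bijection $\phi(x)_p=x_p-\max_{q\lessdot p}x_q$ (empty $\max=0$). For $I\subseteq R$ with $n$ elements and any linear extension $L:I\to[n]$ (order-preserving bijection), $\rho_I=t_{L^{-1}(1)}\circ\cdots\circ t_{L^{-1}(n)}$ (independent of $L$); $\rho_{i,j}=\rho_{[i]\times[j]}$ and $\rho=\rho_R$. With $m=\min(r,s)$, $\mathrm{RSK}=\rho^{-1}_{r-m+1,s-m+1}\circ\cdots\circ\rho^{-1}_{r-2,s-2}\circ\rho^{-1}_{r-1,s-1}\circ\phi^{-1}$ (equal to $\phi^{-1}$ if $m=1$). With $F_k=\{(i,j)\in R:i-j=k\}$, $\mathrm{Pro}^P=\rho_{F_{r-s+1}}\circ\cdots\circ\rho_{F_{r-2}}\circ\rho_{F_{r-1}}$ and $\mathrm{Pro}^Q=\rho_{F_{r-s-1}}\circ\cdots\circ\rho_{F_{2-s}}\circ\rho_{F_{1-s}}$ (empty compositions are the identity). For a general rectangle $[i_1,i_2]\times[j_1,j_2]$ these maps are defined by translating it to $[i_2-i_1+1]\times[j_2-j_1+1]$. **Action on labelings of moon polyominoes.** Let $R=[i_1,i_2]\times[j_1,j_2]$ be a maximal rectangle of a moon polyomino $\mathcal M$. Every box of $\mathcal M\setminus R$ lies either in a down-diagonal intersecting $R$ (type D: $j\in[j_1,j_2]$, $i\notin[i_1,i_2]$)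 or in an up-diagonal intersecting $R$ (type U: $i\in[i_1,i_2]$, $j\notin[j_1,j_2]$). Each map $\psi$ in the set $\left\{\mathrm{RSK}^{-1}\circ\mathrm{Pro}^P\circ\mathrm{RSK},\ \mathrm{RSK}^{-1}\circ\mathrm{Pro}^Q\circ\mathrm{RSK},\ \phi\circ\rho^{-1}\circ\phi^{-1}\right\}$, acting on $R$, is extended to a map $\mathbb R^{\mathcal M}\to\mathbb R^{\mathcal N}$ as follows: apply $\psi$ to the labels in $R$, and move the boxes outside $R$ together with their labels by: - for $\mathrm{RSK}^{-1}\circ\mathrm{Pro}^P\circ\mathrm{RSK}$: type D boxes move $(i,j)\mapsto(i,j-1)$, type U boxes do not move; - for $\mathrm{RSK}^{-1}\circ\mathrm{Pro}^Q\circ\mathrm{RSK}$: type U boxes move $(i,j)\mapsto(i-1,j)$, type D boxes do not move; - for $\phi\circ\rho^{-1}\circ\phi^{-1}$: type D boxes move $(i,j)\mapsto(i,j-1)$ and type U boxes move $(i,j)\mapsto(i-1,j)$. Here $\mathcal N$ is the resulting polyomino, assumed to be a moon polyomino (equivalent to $\mathcal M$ under permutation of up- and down-diagonals). Each maximal rectangle of $\mathcal M$ corresponds to the maximal rectangle of $\mathcal N$ with the same dimensions. In $\psi_1\circ\psi_2$, the map $\psi_2$ is applied to $R_2\subseteq\mathcal M$, and then $\psi_1$ is applied to the maximal rectangle corresponding to $R_1$ in the resulting polyomino; similarly for $\psi_2\circ\psi_1$. The equality asserts that both compositions end at the same polyomino and agree as maps on $\mathbb R^{\mathcal M}$. *)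

theory Defs
  imports Complex_Main "HOL-Library.FuncSet" "HOL-Library.Product_Order"
begin

section \<open>Moon polyominoes\<close>

type_synonym box = "int \<times> int"

definition up_diagonal :: "box set \<Rightarrow> int \<Rightarrow> int set" where
  "up_diagonal M i = {j. (i, j) \<in> M}"

definition down_diagonal :: "box set \<Rightarrow> int \<Rightarrow> int set" where
  "down_diagonal M j = {i. (i, j) \<in> M}"

definition polyomino :: "box set \<Rightarrow> bool" where
  "polyomino M \<longleftrightarrow> finite M"

definition int_interval :: "int set \<Rightarrow> bool" where
  "int_interval A \<longleftrightarrow> (\<forall>a\<in>A. \<forall>b\<in>A. {a..b} \<subseteq> A)"

definition convex_polyomino :: "box set \<Rightarrow> bool" where
  "convex_polyomino M \<longleftrightarrow>
     (\<forall>i. int_interval (up_diagonal M i)) \<and> (\<forall>j. int_interval (down_diagonal M j))"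

definition intersection_free :: "box set \<Rightarrow> bool" where
  "intersection_free M \<longleftrightarrow>
     (\<forall>i1 i2. up_diagonal M i1 \<subseteq> up_diagonal M i2 \<or> up_diagonal M i2 \<subseteq> up_diagonal M i1)"

definition moon_polyomino :: "box set \<Rightarrow> bool" where
  "moon_polyomino M \<longleftrightarrow> polyomino M \<and> convex_polyomino M \<and> intersection_free M"

text \<open>\<open>Rect i1 i2 j1 j2\<close> stands for \<open>[i1,i2] \<times> [j1,j2]\<close>. Only nonempty rectangles are used
  (\<open>proper_rect\<close>); for these the four bounds are determined by the set of boxes.\<close>

datatype rect = Rect (imin: int) (imax: int) (jmin: int) (jmax: int)

definition boxes :: "rect \<Rightarrow> box set" where
  "boxes R = {imin R..imax R} \<times> {jmin R..jmax R}"

definition proper_rect :: "rect \<Rightarrow> bool" where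
  "proper_rect R \<longleftrightarrow> imin R \<le> imax R \<and> jmin R \<le> jmax R"

definition isize :: "rect \<Rightarrow> int" where
  "isize R = imax R - imin R + 1"

definition jsize :: "rect \<Rightarrow> int" where
  "jsize R = jmax R - jmin R + 1"

definition maximal_rect :: "box set \<Rightarrow> rect \<Rightarrow> bool" where
  "maximal_rect M R \<longleftrightarrow> proper_rect R \<and> boxes R \<subseteq> M \<and>
     (\<forall>R'. proper_rect R' \<and> boxes R' \<subseteq> M \<and> boxes R \<subseteq> boxes R' \<longrightarrow> boxes R' = boxes R)"

section \<open>Toggles, transfer map, rowmotion, promotion and RSK on \<open>[r] \<times> [s]\<close>\<close>

text \<open>A labeling of \<open>[r] \<times> [s]\<close> is represented by a function on all of \<open>box\<close>. The maps below
  (toggles being used at boxes of \<open>[r] \<times> [s]\<close> only) leave labels outside \<open>[r] \<times> [s]\<close>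
  unchanged, and the resulting labels inside do not depend on labels outside. They are bijections
  of \<open>box \<Rightarrow> real\<close>, so that \<open>inv\<close> restricts to the inverse on labelings of
  \<open>[r] \<times> [s]\<close>. The order on \<open>box\<close> is the product order.\<close>

type_synonym labeling = "box \<Rightarrow> real"

definition grid :: "int \<Rightarrow> int \<Rightarrow> box set" where
  "grid r s = {1..r} \<times> {1..s}"

definition covered_by :: "int \<Rightarrow> int \<Rightarrow> box \<Rightarrow> box \<Rightarrow> bool" where
  "covered_by r s p q \<longleftrightarrow> p \<in> grid r s \<and> q \<in> grid r s \<and> p < q \<and>
     \<not> (\<exists>z\<in>grid r s. p < z \<and> z < q)"

definition max0 :: "real set \<Rightarrow> real" where
  "max0 A = (if A = {} then 0 else Max A)"

definition min1 :: "real set \<Rightarrow> real" where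
  "min1 A = (if A = {} then 1 else Min A)"

definition toggle :: "int \<Rightarrow> int \<Rightarrow> box \<Rightarrow> labeling \<Rightarrow> labeling" where
  "toggle r s p x =
     x(p := min1 (x ` {q. covered_by r s p q}) + max0 (x ` {q. covered_by r s q p}) - x p)"

definition transfer :: "int \<Rightarrow> int \<Rightarrow> labeling \<Rightarrow> labeling" where
  "transfer r s x =
     (\<lambda>p. if p \<in> grid r s then x p - max0 (x ` {q. covered_by r s q p}) else x p)"

definition linear_extension :: "box set \<Rightarrow> (box \<Rightarrow> nat) \<Rightarrow> bool" where
  "linear_extension I L \<longleftrightarrow>
     bij_betw L I {1..card I} \<and> (\<forall>p\<in>I. \<forall>q\<in>I. p \<le> q \<longrightarrow> L p \<le> L q)"

text \<open>Since \<open>foldr f [a, b, c] = f a \<circ> f b \<circ> f c\<close>, this is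
  \<open>t\<close> at \<open>L\<^sup>-\<^sup>1(1)\<close> after \<dots> after \<open>t\<close> at \<open>L\<^sup>-\<^sup>1(n)\<close>. The result does not depend on the
  choice of \<open>L\<close>, as toggles at incomparable elements commute.\<close>

definition rho :: "int \<Rightarrow> int \<Rightarrow> box set \<Rightarrow> labeling \<Rightarrow> labeling" where
  "rho r s I =
     (let L = (SOME L. linear_extension I L)
      in foldr (toggle r s) (map (inv_into I L) [1..<Suc (card I)]))"

definition RSK :: "int \<Rightarrow> int \<Rightarrow> labeling \<Rightarrow> labeling" where
  "RSK r s =
     fold (\<lambda>k. inv (rho r s (grid (r - k) (s - k)))) [1..min r s - 1] \<circ> inv (transfer r s)"

definition file_diagonal :: "int \<Rightarrow> int \<Rightarrow> int \<Rightarrow> box set" where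
  "file_diagonal r s k = {(i, j) \<in> grid r s. i - j = k}"

text \<open>In \<open>ProP\<close> the rightmost (first applied) factor has the largest index, hence \<open>foldr\<close>;
  in \<open>ProQ\<close>, as in \<open>RSK\<close>, it has the smallest index, hence \<open>fold\<close>.\<close>

definition ProP :: "int \<Rightarrow> int \<Rightarrow> labeling \<Rightarrow> labeling" where
  "ProP r s = foldr (\<lambda>k. rho r s (file_diagonal r s k)) [r - s + 1..r - 1]"

definition ProQ :: "int \<Rightarrow> int \<Rightarrow> labeling \<Rightarrow> labeling" where
  "ProQ r s = fold (\<lambda>k. rho r s (file_diagonal r s k)) [1 - s..r - s - 1]"

section \<open>The action on labelings of moon polyominoes\<close>

text \<open>The three kinds of maps. They are kept apart by name because the movement of the boxes
  outside the rectangle depends on the kind and not only on the map on the rectangle.\<close>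

datatype kind = ConjProP | ConjProQ | ConjRowInv

fun psi :: "kind \<Rightarrow> int \<Rightarrow> int \<Rightarrow> labeling \<Rightarrow> labeling" where
  "psi ConjProP r s = inv (RSK r s) \<circ> ProP r s \<circ> RSK r s"
| "psi ConjProQ r s = inv (RSK r s) \<circ> ProQ r s \<circ> RSK r s"
| "psi ConjRowInv r s = transfer r s \<circ> inv (rho r s (grid r s)) \<circ> inv (transfer r s)"

text \<open>\<open>psi\<close> on a general rectangle, by translation to \<open>[isize R] \<times> [jsize R]\<close>.\<close>

definition psi_on :: "kind \<Rightarrow> rect \<Rightarrow> labeling \<Rightarrow> labeling" where
  "psi_on k R x =
     (\<lambda>(i, j). psi k (isize R) (jsize R) (\<lambda>(a, b). x (a + imin R - 1, b + jmin R - 1))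
                 (i - imin R + 1, j - jmin R + 1))"

definition type_D :: "rect \<Rightarrow> box \<Rightarrow> bool" where
  "type_D R p \<longleftrightarrow> snd p \<in> {jmin R..jmax R} \<and> fst p \<notin> {imin R..imax R}"

definition type_U :: "rect \<Rightarrow> box \<Rightarrow> bool" where
  "type_U R p \<longleftrightarrow> fst p \<in> {imin R..imax R} \<and> snd p \<notin> {jmin R..jmax R}"

definition move_box :: "kind \<Rightarrow> rect \<Rightarrow> box \<Rightarrow> box" where
  "move_box k R p =
     (if type_D R p \<and> k \<in> {ConjProP, ConjRowInv} then (fst p, snd p - 1)
      else if type_U R p \<and> k \<in> {ConjProQ, ConjRowInv} then (fst p - 1, snd p)
      else p)"

definition act_shape :: "kind \<Rightarrow> rect \<Rightarrow> box set \<Rightarrow> box set" where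
  "act_shape k R M = move_box k R ` M"

text \<open>Labelings of \<open>M\<close> are the elements of \<open>M \<rightarrow>\<^sub>E UNIV\<close>. If \<open>R\<close> is a maximal rectangle of
  the moon polyomino \<open>M\<close> and \<open>act_shape k R M\<close> is a moon polyomino, then \<open>move_box k R\<close> is
  injective on \<open>M\<close>, so that \<open>inv_into\<close> yields the unique box that moved to \<open>q\<close>.\<close>

definition act_labels :: "kind \<Rightarrow> rect \<Rightarrow> box set \<Rightarrow> labeling \<Rightarrow> labeling" where
  "act_labels k R M x =
     (\<lambda>q\<in>act_shape k R M. if q \<in> boxes R then psi_on k R x q
                          else x (inv_into M (move_box k R) q))"

definition corresponding_rect :: "box set \<Rightarrow> rect \<Rightarrow> rect" where
  "corresponding_rect N R =
     (THE R'. maximal_rect N R' \<and> isize R' = isize R \<and> jsize R' = jsize R)"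

text \<open>\<open>comp_shape k1 R1 k2 R2\<close> and \<open>comp_labels k1 R1 k2 R2\<close> describe
  \<open>\<psi>1 \<circ> \<psi>2\<close>: first the map of kind \<open>k2\<close> at \<open>R2\<close>, then the map of kind \<open>k1\<close> at the rectangle
  of the resulting polyomino corresponding to \<open>R1\<close>.\<close>

definition comp_shape :: "kind \<Rightarrow> rect \<Rightarrow> kind \<Rightarrow> rect \<Rightarrow> box set \<Rightarrow> box set" where
  "comp_shape k1 R1 k2 R2 M =
     (let N = act_shape k2 R2 M in act_shape k1 (corresponding_rect N R1) N)"

definition comp_labels ::
    "kind \<Rightarrow> rect \<Rightarrow> kind \<Rightarrow> rect \<Rightarrow> box set \<Rightarrow> labeling \<Rightarrow> labeling" where
  "comp_labels k1 R1 k2 R2 M x =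
     (let N = act_shape k2 R2 M
      in act_labels k1 (corresponding_rect N R1) N (act_labels k2 R2 M x))"

end

(* Continuous row and column crystal operators act on real matrices and commute with each other. The
   half of the RSK pattern cut off by the diagonal through the corner box (r, s) that contains the
   last row is a complete invariant for row operators, the other half for column operators; a matrix
   is determined by both halves. Each of the three maps psi turns x, restricted to the columns at
   distance dj from the left border, into a row equivalent matrix shifted by dj, likewise for columns
   of the matrix and di, and intertwines row (column) operators up to an index shift by di (dj),
   where di, dj in {0, 1} are the displacements of type U and type D boxes.

   Distinct maximal rectangles cross: one, R1, is wider and the other, R2, is taller. Acting on R1
   changes the labels of R2 by row operators within the rows of R1, and these pass through psi2
   unchanged outside the crossing. Inside the crossing both compositions are row equivalent to the
   labels after psi2 alone and column equivalent to the labels after psi1 alone, hence equal. *)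

theory Submission
  imports Defs
begin

section \<open>Last passage percolation and row operations\<close>

text \<open>The obstacle is that conjugated promotion has no usable formula on labelings: it is a
  chain of toggles of an RSK pattern, followed by an inverse of RSK. It is therefore never computed.
  One half of the pattern is fixed by the toggles; the other obeys a recursion that is also solved
  by a matrix explicitly row equivalent to the shifted input. Since both halves determine a matrix,
  all other properties of the map, even its independence of labels outside the rectangle, follow
  from two equivalences.

  Crystal operators are parametrised by a carrier load and not by the weight moved. The load
  survives the passage to the next layer \<open>nxt\<close> of the pattern, and cutting off columns
  only replaces it by another load. The local identities are then piecewise linear in a few reals.

  A shift by one costs a column: the equivalence is known only on the remaining ones. This suffices
  in the crossing because the intermediate shapes are moon polyominoes, which forces the smaller
  ranges to stay inside the larger ones after the move.\<close>

type_synonym mat = "nat \<Rightarrow> nat \<Rightarrow> real"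

fun lpp :: "mat \<Rightarrow> mat" where
  "lpp x 0 0 = x 0 0"
| "lpp x 0 (Suc j) = lpp x 0 j + x 0 (Suc j)"
| "lpp x (Suc i) 0 = lpp x i 0 + x (Suc i) 0"
| "lpp x (Suc i) (Suc j) = max (lpp x i (Suc j)) (lpp x (Suc i) j) + x (Suc i) (Suc j)"

text \<open>Toggling \<open>lpp x\<close> from the bottom to the top of a rectangle with its last row and column removed
  (inverse rowmotion) yields \<open>lpp (nxt x)\<close> there.\<close>

definition nxt :: "mat \<Rightarrow> mat" where
  "nxt x i j = min (lpp x (Suc i) j) (lpp x i (Suc j)) - lpp x i j"

text \<open>A continuous crystal operator, moving weight from row \<open>i\<close> to row \<open>i + 1\<close>. The state \<open>rowst\<close> is
  the load of a carrier that passes the columns from left to right with initial load \<open>th\<close>; a smaller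
  \<open>th\<close> moves more weight.\<close>

fun rowst :: "nat \<Rightarrow> real \<Rightarrow> mat \<Rightarrow> nat \<Rightarrow> real" where
  "rowst i th x 0 = th"
| "rowst i th x (Suc k) = x (Suc i) k + max 0 (rowst i th x k - x i k)"

definition rowop :: "nat \<Rightarrow> real \<Rightarrow> mat \<Rightarrow> mat" where
  "rowop i th x = (\<lambda>i' k. if i' = i then min (x i k) (rowst i th x k)
     else if i' = Suc i then x (Suc i) k + max 0 (x i k - rowst i th x k) else x i' k)"

lemma rowop_simps [simp]:
  "rowop i th x i k = min (x i k) (rowst i th x k)"
  "rowop i th x (Suc i) k = x (Suc i) k + max 0 (x i k - rowst i th x k)"
  "i' \<noteq> i \<Longrightarrow> i' \<noteq> Suc i \<Longrightarrow> rowop i th x i' k = x i' k"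
  by (simp_all add: rowop_def)

lemma lpp_cong: "(\<And>i' j'. i' \<le> i \<Longrightarrow> j' \<le> j \<Longrightarrow> x i' j' = z i' j') \<Longrightarrow> lpp x i j = lpp z i j"
  by (induction x i j rule: lpp.induct) auto

lemma lpp_rowop_above: "i' < i \<Longrightarrow> lpp (rowop i th x) i' k = lpp x i' k"
  by (rule lpp_cong) auto

lemma lpp_next_row:
  assumes "\<And>k. lpp z i k = lpp x i k" "\<And>k. z (Suc i) k = x (Suc i) k"
  shows "lpp z (Suc i) k = lpp x (Suc i) k"
  by (induction k) (simp_all add: assms)

text \<open>The row operation at \<open>i\<close> changes only row \<open>i\<close> of \<open>lpp\<close>, and its state is read off from
  the state of the operation at \<open>i - 1\<close> on \<open>nxt x\<close>.\<close>

lemma lpp_rowop_Suc: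
  defines "y \<equiv> \<lambda>i th x. rowop (Suc i) th x"
  shows "lpp (y i th x) (Suc i) k = min (lpp x (Suc i) k) (lpp x i k + rowst i th (nxt x) k)
     \<and> rowst (Suc i) th x (Suc k) = lpp x (Suc (Suc i)) k - lpp x (Suc i) k
          + max 0 (rowst i th (nxt x) k - lpp x (Suc i) k + lpp x i k)
     \<and> lpp (y i th x) (Suc (Suc i)) k = lpp x (Suc (Suc i)) k"
proof (induction k)
  case 0
  show ?case by (simp add: y_def lpp_rowop_above min_def max_def)
next
  case (Suc k)
  \<comment> \<open>Three consecutive rows of \<open>lpp\<close> at column \<open>k\<close>, with
    suffix 1 at column \<open>k + 1\<close>, two entries of \<open>x\<close> and the carrier loads.
    Once these are named, every claim of the induction step is a piecewise linear identity.\<close>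
  define U V Z U1 V1 Z1 a b e e1 eN where "U = lpp x i k" "V = lpp x (Suc i) k"
    "Z = lpp x (Suc (Suc i)) k" "U1 = lpp x i (Suc k)" "V1 = lpp x (Suc i) (Suc k)"
    "Z1 = lpp x (Suc (Suc i)) (Suc k)" "a = x (Suc i) (Suc k)" "b = x (Suc (Suc i)) (Suc k)"
    "e = rowst (Suc i) th x (Suc k)" "e1 = rowst i th (nxt x) (Suc k)" "eN = rowst i th (nxt x) k"
  note d = this
  have 1: "V1 = max U1 V + a" "Z1 = max V1 Z + b" by (auto simp: d)
  have 2: "e1 = min Z V1 - V + max 0 (eN - (min V U1 - U))" by (simp add: d nxt_def)
  have 3: "lpp (y i th x) (Suc i) k = min V (U + eN)" "e = Z - V + max 0 (eN - V + U)"
    "lpp (y i th x) (Suc (Suc i)) k = Z" using Suc by (auto simp: d)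
  have 4: "lpp (y i th x) (Suc i) (Suc k) = max U1 (min V (U + eN)) + min a e"
    using 3(1) by (simp add: y_def lpp_rowop_above del: rowst.simps flip: d)
  have 5: "lpp (y i th x) (Suc i) (Suc k) = min V1 (U1 + e1)"
    unfolding 4 2 3 1 by (smt (verit))
  have 6: "rowst (Suc i) th x (Suc (Suc k)) = b + max 0 (e - a)" by (simp add: d)
  have 7: "lpp (y i th x) (Suc (Suc i)) (Suc k) =
     max (lpp (y i th x) (Suc i) (Suc k)) Z + (b + max 0 (a - e))"
    using 3(3) by (simp add: y_def del: rowst.simps flip: d(6-9))
  have 8: "rowst (Suc i) th x (Suc (Suc k)) = Z1 - V1 + max 0 (e1 - V1 + U1)"
    unfolding 6 2 3 1 by (smt (verit))
  have 9: "lpp (y i th x) (Suc (Suc i)) (Suc k) = Z1"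
    unfolding 7 4 2 3 1 by (smt (verit))
  show ?case using 5 8 9 unfolding d by blast
qed

text \<open>There is no row above from which to read the state. Its place is taken by
  \<open>g\<close>, the weight of the path that stays in row 1, with \<open>th\<close> instead of
  the entry of row 0 above its start.\<close>

lemma lpp_rowop_0:
  defines "y \<equiv> \<lambda>th x. rowop 0 th x"
  defines "g \<equiv> \<lambda>th x k. th + (\<Sum>j\<le>k. x 1 j)"
  shows "lpp (y th x) 0 k = lpp x 0 k + min 0 (g th x k - lpp x 1 k)
     \<and> rowst 0 th x (Suc k) = max (g th x k) (lpp x 1 k) - lpp x 0 k
     \<and> lpp (y th x) 1 k = lpp x 1 k"
proof (induction k)
  case 0
  show ?case by (simp add: y_def g_def lpp_rowop_above min_def max_def)
next
  case (Suc k)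
  define V Z V1 Z1 a b e G where "V = lpp x 0 k"
    "Z = lpp x 1 k" "V1 = lpp x 0 (Suc k)"
    "Z1 = lpp x 1 (Suc k)" "a = x 0 (Suc k)" "b = x 1 (Suc k)"
    "e = rowst 0 th x (Suc k)" "G = g th x k"
  note d = this
  have 1: "V1 = V + a" "Z1 = max V1 Z + b" by (auto simp: d)
  have 2: "g th x (Suc k) = G + b" by (simp add: d g_def)
  have 3: "lpp (y th x) 0 k = V + min 0 (G - Z)" "e = max G Z - V"
    "lpp (y th x) 1 k = Z" using Suc by (auto simp: d)
  have 4: "lpp (y th x) 0 (Suc k) = V + min 0 (G - Z) + min a e"
    using 3(1) by (simp add: y_def d)
  have 7: "lpp (y th x) 1 (Suc k) =
     max (lpp (y th x) 0 (Suc k)) Z + (b + max 0 (a - e))"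
    using 3(3) by (simp add: y_def d)
  have 6: "rowst 0 th x (Suc (Suc k)) = b + max 0 (e - a)" by (simp add: d)
  have "lpp (y th x) 0 (Suc k) = V1 + min 0 (G + b - Z1)"
    unfolding 4 3 1 by (smt (verit))
  moreover have "rowst 0 th x (Suc (Suc k)) = max (G + b) Z1 - V1"
    unfolding 6 3 1 by (smt (verit))
  moreover have "lpp (y th x) 1 (Suc k) = Z1"
    unfolding 7 4 3 1 by (smt (verit))
  ultimately show ?case unfolding 2 d by blast
qed

text \<open>Row \<open>i + 1\<close> is the critical one; every later row of \<open>lpp\<close> is
  computed from it and from entries that the operation leaves alone.\<close>

lemma lpp_rowop: "i' \<noteq> i \<Longrightarrow> lpp (rowop i th x) i' k = lpp x i' k"
proof -
  have *: "lpp (rowop i th x) (Suc i) k = lpp x (Suc i) k" for k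
    using lpp_rowop_0[of th x] lpp_rowop_Suc[of _ th x] by (cases i) auto
  have "lpp (rowop i th x) (Suc i + d) k = lpp x (Suc i + d) k" for d k
  proof (induction d arbitrary: k)
    case (Suc d)
    show ?case unfolding add_Suc_right by (rule lpp_next_row) (use Suc in simp_all)
  qed (use * in simp)
  then have "lpp (rowop i th x) i' k = lpp x i' k" if "Suc i \<le> i'"
    using that by (metis le_iff_add)
  moreover assume "i' \<noteq> i"
  then have "i' < i \<or> Suc i \<le> i'" by auto
  ultimately show ?thesis using lpp_rowop_above by blast
qed

text \<open>In row 0 the minimum of the two neighbours and the entry itself change by the same
  amount \<open>min 0 (G - Z)\<close>, so the operation at 0 leaves no trace in the later layers of
  the pattern.\<close>

lemma nxt_rowop_0: "nxt (rowop 0 th x) = nxt x"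
proof (intro ext)
  fix i k
  define V Z V1 G b where "V = lpp x 0 k" "Z = lpp x 1 k" "V1 = lpp x 0 (Suc k)"
    "G = th + (\<Sum>j\<le>k. x 1 j)" "b = x 1 (Suc k)" note d = this
  have 1: "lpp x 1 (Suc k) = max V1 Z + b" by (simp add: d)
  show "nxt (rowop 0 th x) i k = nxt x i k"
  proof (cases i)
    case 0
    have "nxt (rowop 0 th x) 0 k =
        min Z (V1 + min 0 (G + b - (max V1 Z + b))) - (V + min 0 (G - Z))"
      using lpp_rowop_0[of th x k] lpp_rowop_0[of th x "Suc k"] 1
      by (simp add: nxt_def d algebra_simps del: lpp.simps)
    also have "\<dots> = min Z V1 - V" by (smt (verit))
    finally show ?thesis by (simp add: 0 nxt_def d)
  qed (simp add: nxt_def lpp_rowop del: lpp.simps)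
qed

text \<open>The changed row \<open>i + 1\<close> of \<open>lpp\<close> enters \<open>nxt\<close> in
  row \<open>i\<close>, as a neighbour, and in row \<open>i + 1\<close>; hence the index drops by
  one. The threshold is preserved.\<close>

lemma nxt_rowop_Suc: "nxt (rowop (Suc i) th x) = rowop i th (nxt x)"
proof (intro ext)
  fix i' k
  consider "i' = i" | "i' = Suc i" | "i' \<noteq> i" "i' \<noteq> Suc i" by blast
  then show "nxt (rowop (Suc i) th x) i' k = rowop i th (nxt x) i' k"
  proof cases
    case 1
    then show ?thesis using lpp_rowop_Suc[of i th x k]
      by (simp add: nxt_def lpp_rowop del: lpp.simps)
  next
    case 2
    define U V Z U1 V1 eN where d: "U = lpp x i k" "V = lpp x (Suc i) k"
      "Z = lpp x (Suc (Suc i)) k" "U1 = lpp x i (Suc k)" "V1 = lpp x (Suc i) (Suc k)"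
      "eN = rowst i th (nxt x) k"
    define a where "a = x (Suc i) (Suc k)"
    have 1: "V1 = max U1 V + a" by (simp add: d a_def)
    have 2: "lpp (rowop (Suc i) th x) (Suc i) (Suc k) =
       min V1 (U1 + (min Z V1 - V + max 0 (eN - (min V U1 - U))))"
      using lpp_rowop_Suc[of i th x "Suc k"] by (simp add: d nxt_def del: lpp.simps)
    have 3: "lpp (rowop (Suc i) th x) (Suc i) k = min V (U + eN)"
      using lpp_rowop_Suc[of i th x k] by (simp add: d nxt_def)
    have "nxt (rowop (Suc i) th x) (Suc i) k = min Z (min V1 (U1 + (min Z V1 - V
        + max 0 (eN - (min V U1 - U))))) - min V (U + eN)"
      by (simp only: nxt_def 2 3) (simp add: lpp_rowop d)
    also have "\<dots> = (min Z V1 - V) + max 0 ((min V U1 - U) - eN)"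
      unfolding 1 by (smt (verit))
    also have "\<dots> = rowop i th (nxt x) (Suc i) k"
      by (simp add: nxt_def d del: lpp.simps)
    finally show ?thesis using \<open>i' = Suc i\<close> by simp
  next
    case 3
    then show ?thesis by (simp add: nxt_def lpp_rowop)
  qed
qed

section \<open>Transposition, column operations and their commutation with row operations\<close>

definition tr :: "mat \<Rightarrow> mat" where
  "tr x = (\<lambda>i j. x j i)"

lemma tr_apply [simp]: "tr x i j = x j i"
  by (simp add: tr_def)

lemma tr_tr [simp]: "tr (tr x) = x"
  by (simp add: tr_def)

lemma lpp_tr: "lpp (tr x) i j = lpp x j i"
  by (induction x j i rule: lpp.induct) (simp_all add: max.commute)

lemma nxt_tr: "nxt (tr x) = tr (nxt x)"
  by (intro ext) (simp add: nxt_def lpp_tr min.commute del: lpp.simps)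

definition colst :: "nat \<Rightarrow> real \<Rightarrow> mat \<Rightarrow> nat \<Rightarrow> real" where
  "colst j th x = rowst j th (tr x)"

definition colop :: "nat \<Rightarrow> real \<Rightarrow> mat \<Rightarrow> mat" where
  "colop j th x = tr (rowop j th (tr x))"

lemma colst_simps [simp]:
  "colst j th x 0 = th"
  "colst j th x (Suc k) = x k (Suc j) + max 0 (colst j th x k - x k j)"
  by (simp_all add: colst_def)

lemma colop_simps [simp]:
  "colop j th x i j = min (x i j) (colst j th x i)"
  "colop j th x i (Suc j) = x i (Suc j) + max 0 (x i j - colst j th x i)"
  "j' \<noteq> j \<Longrightarrow> j' \<noteq> Suc j \<Longrightarrow> colop j th x i j' = x i j'"
  by (simp_all add: colop_def colst_def)

lemma rowst_cong:
  "(\<And>k'. k' < k \<Longrightarrow> x i k' = z i k' \<and> x (Suc i) k' = z (Suc i) k') \<Longrightarrow> rowst i th x k = rowst i th z k"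
  by (induction k) auto

lemma rowst_add:
  "(\<And>k'. k0 \<le> k' \<Longrightarrow> x i k' = z i k' \<and> x (Suc i) k' = z (Suc i) k')
     \<Longrightarrow> rowst i th x k0 = rowst i th z k0 \<Longrightarrow> rowst i th x (k0 + d) = rowst i th z (k0 + d)"
  by (induction d) auto

text \<open>The rows \<open>i\<close>, \<open>i + 1\<close> of the block where the two operations
  meet are \<open>a c\<close> and \<open>b d\<close>; \<open>e\<close> and \<open>f\<close> are the
  loads with which the row and the column carrier enter it. Suffix 1 marks entries after the row
  operation, suffix 2 entries after the column operation; \<open>e1\<close>, \<open>e2\<close> and
  \<open>f1\<close> are later loads.\<close>

lemma block_commute:
  fixes e f a b c d :: real
  defines "e1 \<equiv> b + max 0 (e - a)" and "a1 \<equiv> min a e" and "b1 \<equiv> b + max 0 (a - e)"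
  defines "c1 \<equiv> min c e1" and "d1 \<equiv> d + max 0 (c - e1)" and "e2 \<equiv> d + max 0 (e1 - c)"
  defines "f1 \<equiv> c + max 0 (f - a)" and "a2 \<equiv> min a f" and "c2 \<equiv> c + max 0 (a - f)"
  defines "b2 \<equiv> min b f1" and "d2 \<equiv> d + max 0 (b - f1)"
  shows "d2 + max 0 (b2 + max 0 (e - a2) - c2) = e2"
    and "min a1 f = min a2 e"
    and "min b1 (c1 + max 0 (f - a1)) = b2 + max 0 (a2 - e)"
    and "c1 + max 0 (a1 - f) = min c2 (b2 + max 0 (e - a2))"
    and "d1 + max 0 (b1 - (c1 + max 0 (f - a1))) = d2 + max 0 (c2 - (b2 + max 0 (e - a2)))"
  unfolding assms by ((smt (verit))[])+

text \<open>Between columns \<open>j\<close> and \<open>j + 1\<close> the state of a row operation does change.\<close>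

lemma rowst_colop:
  assumes "k \<noteq> Suc j"
  shows "rowst i th (colop j f x) k = rowst i th x k"
proof -
  have *: "rowst i th (colop j f x) k = rowst i th x k" if "k \<le> j" for k
    by (rule rowst_cong) (use that in auto)
  have **: "rowst i th (colop j f x) (Suc (Suc j)) = rowst i th x (Suc (Suc j))"
    using block_commute(1)[where e = "rowst i th x j" and f = "colst j f x i" and a = "x i j"
      and b = "x (Suc i) j" and c = "x i (Suc j)" and d = "x (Suc i) (Suc j)"]
    by (simp add: *)
  have "rowst i th (colop j f x) (Suc (Suc j) + d) = rowst i th x (Suc (Suc j) + d)" for d
    by (rule rowst_add[OF _ **]) auto
  then have "rowst i th (colop j f x) k = rowst i th x k" if "Suc (Suc j) \<le> k"
    using that by (metis le_iff_add)
  moreover have "k \<le> j \<or> Suc (Suc j) \<le> k" using assms by auto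
  ultimately show ?thesis using * by blast
qed

lemma colst_rowop: "k \<noteq> Suc i \<Longrightarrow> colst j f (rowop i th x) k = colst j f x k"
  using rowst_colop[of k i j f th "tr x"] by (simp add: colst_def colop_def)

text \<open>Outside the 2 by 2 block at most one of the operations acts, and its carrier there does
  not notice the other one. Inside, the claim is \<open>block_commute\<close>.\<close>

lemma rowop_colop: "rowop i th (colop j f x) = colop j f (rowop i th x)"
proof (intro ext)
  fix i' j'
  note b = block_commute(2)[where e = "rowst i th x j" and f = "colst j f x i" and a = "x i j"]
    block_commute(3-4)[where e = "rowst i th x j" and f = "colst j f x i" and a = "x i j"
      and b = "x (Suc i) j" and c = "x i (Suc j)"]
    block_commute(5)[where e = "rowst i th x j" and f = "colst j f x i" and a = "x i j"
      and b = "x (Suc i) j" and c = "x i (Suc j)" and d = "x (Suc i) (Suc j)"]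
  have r: "rowst i th (colop j f x) j = rowst i th x j"
    and c: "colst j f (rowop i th x) i = colst j f x i"
    by (simp_all add: rowst_colop colst_rowop)
  consider "i' = i" "j' = j" | "i' = i" "j' = Suc j" | "i' = Suc i" "j' = j"
    | "i' = Suc i" "j' = Suc j" | "i' \<noteq> i" "i' \<noteq> Suc i" | "j' \<noteq> j" "j' \<noteq> Suc j" by blast
  then show "rowop i th (colop j f x) i' j' = colop j f (rowop i th x) i' j'"
  proof cases
    case 1
    then show ?thesis using b(1) by (simp only: rowop_simps colop_simps rowst.simps colst_simps r c)
  next
    case 2
    then show ?thesis using b(3) by (simp only: rowop_simps colop_simps rowst.simps colst_simps r c)
  next
    case 3
    then show ?thesis using b(2) by (simp only: rowop_simps colop_simps rowst.simps colst_simps r c)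
  next
    case 4
    then show ?thesis using b(4) by (simp only: rowop_simps colop_simps rowst.simps colst_simps r c)
  next
    case 5
    then show ?thesis by (cases "j' = j \<or> j' = Suc j") (auto simp: colst_rowop)
  next
    case 6
    then show ?thesis by (cases "i' = i \<or> i' = Suc i") (auto simp: rowst_colop)
  qed
qed

section \<open>Equivalence of matrices on a finite block\<close>

definition agree :: "nat \<Rightarrow> nat \<Rightarrow> mat \<Rightarrow> mat \<Rightarrow> bool" where
  "agree r s x z \<longleftrightarrow> (\<forall>i<r. \<forall>j<s. x i j = z i j)"

text \<open>Thresholds are arbitrary. \<open>agree\<close> is a generator because matrices carry
  entries outside the block, \<open>sym\<close> because an operation moves weight in one direction
  only.\<close>

inductive row_eq :: "nat \<Rightarrow> nat \<Rightarrow> mat \<Rightarrow> mat \<Rightarrow> bool" for r s where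
  agree: "agree r s x z \<Longrightarrow> row_eq r s x z"
| op: "Suc i < r \<Longrightarrow> row_eq r s x (rowop i th x)"
| sym: "row_eq r s x z \<Longrightarrow> row_eq r s z x"
| trans: "row_eq r s x y \<Longrightarrow> row_eq r s y z \<Longrightarrow> row_eq r s x z"

definition col_eq :: "nat \<Rightarrow> nat \<Rightarrow> mat \<Rightarrow> mat \<Rightarrow> bool" where
  "col_eq r s x z \<longleftrightarrow> row_eq s r (tr x) (tr z)"

lemma agree_refl [simp]: "agree r s x x"
  by (simp add: agree_def)

lemma agree_sym: "agree r s x z \<Longrightarrow> agree r s z x"
  by (simp add: agree_def)

lemma agree_trans: "agree r s x y \<Longrightarrow> agree r s y z \<Longrightarrow> agree r s x z"
  by (simp add: agree_def)

lemma agree_mono: "agree r s x z \<Longrightarrow> r' \<le> r \<Longrightarrow> s' \<le> s \<Longrightarrow> agree r' s' x z"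
  by (simp add: agree_def)

lemma agree_tr: "agree s r (tr x) (tr z) \<longleftrightarrow> agree r s x z"
  by (auto simp: agree_def)

lemma agree_lpp: "agree r s x z \<Longrightarrow> i < r \<Longrightarrow> j < s \<Longrightarrow> lpp x i j = lpp z i j"
  by (rule lpp_cong) (simp add: agree_def)

lemma agree_nxt: "agree (Suc r) (Suc s) x z \<Longrightarrow> agree r s (nxt x) (nxt z)"
  unfolding agree_def[of r] nxt_def by (auto simp: agree_lpp simp del: lpp.simps)

lemma agree_nxt_diff: "agree r s x z \<Longrightarrow> agree (r - 1) (s - 1) (nxt x) (nxt z)"
  by (cases r; cases s) (simp_all add: agree_nxt agree_def[of 0] agree_def[of _ 0])

lemma agree_nxt_funpow: "agree r s x z \<Longrightarrow> agree (r - l) (s - l) ((nxt ^^ l) x) ((nxt ^^ l) z)"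
proof (induction l)
  case (Suc l)
  then show ?case using agree_nxt_diff by fastforce
qed simp

lemma agree_rowop: "agree r s x z \<Longrightarrow> Suc i < r \<Longrightarrow> agree r s (rowop i th x) (rowop i th z)"
proof -
  assume a: "agree r s x z" and i: "Suc i < r"
  have "rowst i th x k = rowst i th z k" if "k < s" for k
    by (rule rowst_cong) (use a i that in \<open>auto simp: agree_def\<close>)
  then show ?thesis using a i by (auto simp: agree_def rowop_def)
qed

lemma col_eq_tr: "col_eq r s (tr x) (tr z) \<longleftrightarrow> row_eq s r x z"
  by (simp add: col_eq_def)

lemma row_eq_refl [simp]: "row_eq r s x x"
  by (simp add: row_eq.agree)

definition shc :: "nat \<Rightarrow> mat \<Rightarrow> mat" where
  "shc c x = (\<lambda>i j. x i (c + j))"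

definition shr :: "nat \<Rightarrow> mat \<Rightarrow> mat" where
  "shr c x = (\<lambda>i j. x (c + i) j)"

lemma shc_apply [simp]: "shc c x i j = x i (c + j)"
  by (simp add: shc_def)

lemma shr_apply [simp]: "shr c x i j = x (c + i) j"
  by (simp add: shr_def)

lemma tr_shc: "tr (shc c x) = shr c (tr x)"
  by (intro ext) simp

lemma tr_shr: "tr (shr c x) = shc c (tr x)"
  by (intro ext) simp

lemma agree_shc: "agree r s x z \<Longrightarrow> c + s' \<le> s \<Longrightarrow> agree r s' (shc c x) (shc c z)"
  by (simp add: agree_def)

lemma agree_shr: "agree r s x z \<Longrightarrow> c + r' \<le> r \<Longrightarrow> agree r' s (shr c x) (shr c z)"
  by (simp add: agree_def)

lemma rowst_shc: "rowst i (rowst i th x c) (shc c x) k = rowst i th x (c + k)"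
  by (induction k) auto

text \<open>A carrier that has passed \<open>c\<close> columns enters the rest with load
  \<open>rowst i th x c\<close>, so on a window of columns a row operation is again a row operation,
  with another threshold.\<close>

lemma shc_rowop: "shc c (rowop i th x) = rowop i (rowst i th x c) (shc c x)"
  by (intro ext) (simp add: rowop_def rowst_shc)

lemma rowst_shr: "rowst i th (shr c x) k = rowst (c + i) th x k"
  by (induction k) auto

lemma shr_rowop: "shr c (rowop (c + i) th x) = rowop i th (shr c x)"
  by (intro ext) (simp add: rowop_def rowst_shr)

lemma row_eq_shc:
  assumes "row_eq r s x z" "c + s' \<le> s"
  shows "row_eq r s' (shc c x) (shc c z)"
  using assms(1)
proof induction
  case (agree x z)
  then show ?case using assms(2) by (intro row_eq.agree agree_shc)
next
  case (op i x th)
  then show ?case unfolding shc_rowop by (rule row_eq.op)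
qed (blast intro: row_eq.sym row_eq.trans)+

text \<open>Row \<open>l\<close> of \<open>pr r x\<close> is row \<open>r - 1 - l\<close> of the RSK pattern of the \<open>r \<times> s\<close> matrix \<open>x\<close>, from
  column 0 up to the main diagonal \<open>l + j = s - 1\<close>; only \<open>l < r\<close> and \<open>l + j < s\<close> are meaningful.\<close>

definition pr :: "nat \<Rightarrow> mat \<Rightarrow> nat \<Rightarrow> nat \<Rightarrow> real" where
  "pr r x l j = lpp ((nxt ^^ l) x) (r - 1 - l) j"

definition same_pr :: "nat \<Rightarrow> nat \<Rightarrow> mat \<Rightarrow> mat \<Rightarrow> bool" where
  "same_pr r s x z \<longleftrightarrow> (\<forall>l j. l < r \<longrightarrow> l + j < s \<longrightarrow> pr r x l j = pr r z l j)"

lemma nxt_funpow_rowop: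
  "(nxt ^^ l) (rowop i th x) = (if l \<le> i then rowop (i - l) th ((nxt ^^ l) x) else (nxt ^^ l) x)"
proof (induction l)
  case (Suc l)
  show ?case
  proof (cases "l \<le> i")
    case True
    then show ?thesis
      using Suc by (cases "i - l") (auto simp: nxt_rowop_Suc nxt_rowop_0 diff_Suc)
  qed (use Suc in simp)
qed simp

text \<open>After \<open>l\<close> layers the operation has either vanished or sits at
  \<open>i - l\<close>, strictly above the row \<open>r - 1 - l\<close> that \<open>pr\<close>
  reads.\<close>

lemma pr_rowop: "Suc i < r \<Longrightarrow> pr r (rowop i th x) l j = pr r x l j"
  by (auto simp: pr_def nxt_funpow_rowop intro: lpp_rowop)

lemma agree_imp_same_pr: "agree r s x z \<Longrightarrow> same_pr r s x z"
  unfolding same_pr_def pr_def by (auto intro!: agree_lpp[OF agree_nxt_funpow])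

lemma row_eq_imp_same_pr: "row_eq r s x z \<Longrightarrow> same_pr r s x z"
proof (induction rule: row_eq.induct)
  case (op i x th)
  then show ?case by (simp add: same_pr_def pr_rowop)
qed (auto simp: agree_imp_same_pr, auto simp: same_pr_def)

section \<open>Row equivalence and the two halves of the RSK pattern\<close>

lemma lpp_col_0: "lpp x i 0 = (\<Sum>i\<le>i. x i 0)"
  by (induction i) auto

text \<open>The matrix reached from \<open>x\<close> by the row operations at \<open>0, \<dots>, m - 1\<close> whose thresholds are
  the desired entries \<open>q\<close> of column 0.\<close>

fun swp :: "(nat \<Rightarrow> real) \<Rightarrow> mat \<Rightarrow> nat \<Rightarrow> mat" where
  "swp q x m i 0 = (if i < m then q i else if i = m then (\<Sum>i\<le>m. x i 0) - (\<Sum>i<m. q i) else x i 0)"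
| "swp q x m i (Suc k) = (if i < m then nxt x i k
     else if i = m then lpp x m (Suc k) - lpp x m k else x i (Suc k))"

lemma swp_0: "swp q x 0 = x"
proof (intro ext)
  fix i k show "swp q x 0 i k = x i k" by (cases k) auto
qed

text \<open>The hypothesis says that \<open>q m\<close> is at most the current entry of row
  \<open>m\<close> in column 0. That entry absorbs the whole initial load, so the later loads do not
  depend on \<open>q\<close>.\<close>

lemma swp_Suc:
  assumes "(\<Sum>i\<le>m. q i) \<le> (\<Sum>i\<le>m. x i 0)"
  shows "rowop m (q m) (swp q x m) = swp q x (Suc m)"
proof -
  let ?e = "rowst m (q m) (swp q x m)"
  let ?A = "(\<Sum>i\<le>m. x i 0) - (\<Sum>i<m. q i)"
  have A: "q m \<le> ?A"
    using assms by (simp add: lessThan_Suc_atMost[symmetric])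
  \<comment> \<open>The load is the gap between two rows of \<open>lpp x\<close>. Capping the
    increments of row \<open>m\<close> of \<open>lpp x\<close> by it gives row \<open>m\<close> of
    \<open>nxt x\<close>.\<close>
  have e: "?e (Suc k) = lpp x (Suc m) k - lpp x m k" for k
  proof (induction k)
    case 0
    then show ?case using A by (simp add: lpp_col_0)
  next
    case (Suc k)
    have "?e (Suc (Suc k)) = x (Suc m) (Suc k) + max 0 (?e (Suc k) - (lpp x m (Suc k) - lpp x m k))"
      by simp
    also have "\<dots> = x (Suc m) (Suc k) + max 0 (lpp x (Suc m) k - lpp x m (Suc k))"
      unfolding Suc by simp
    also have "\<dots> = lpp x (Suc m) (Suc k) - lpp x m (Suc k)"
      by simp
    finally show ?case .
  qed
  show ?thesis
  proof (intro ext)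
    fix i k
    consider "i = m" | "i = Suc m" | "i \<noteq> m" "i \<noteq> Suc m" by blast
    then show "rowop m (q m) (swp q x m) i k = swp q x (Suc m) i k"
    proof cases
      case 1
      then show ?thesis using A
        by (cases k) (simp_all add: e nxt_def del: lpp.simps rowst.simps(2))
    next
      case 2
      show ?thesis
      proof (cases k)
        case 0
        then show ?thesis using A 2 by simp
      next
        case (Suc k')
        have "x (Suc m) (Suc k') + max 0 (lpp x m (Suc k') - lpp x m k' - ?e (Suc k'))
            = lpp x (Suc m) (Suc k') - lpp x (Suc m) k'"
          unfolding e by simp
        then show ?thesis using 2 Suc by (simp del: lpp.simps rowst.simps(2))
      qed
    next
      case 3
      then show ?thesis by (cases k) auto
    qed
  qed
qed

lemma row_eq_swp:
  assumes "\<And>m. m < n \<Longrightarrow> (\<Sum>i\<le>m. q i) \<le> (\<Sum>i\<le>m. x i 0)"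
  shows "row_eq (Suc n) s x (swp q x n)"
proof -
  have "row_eq (Suc n) s x (swp q x m)" if "m \<le> n" for m
    using that
  proof (induction m)
    case 0
    then show ?case by (simp add: swp_0)
  next
    case (Suc m)
    then have "row_eq (Suc n) s (swp q x m) (swp q x (Suc m))"
      using row_eq.op[of m "Suc n" s "swp q x m" "q m"] assms by (simp add: swp_Suc)
    then show ?case using Suc by (auto intro: row_eq.trans)
  qed
  then show ?thesis by blast
qed

text \<open>The columns from 1 on of the fully swept matrix: they do not depend on \<open>q\<close>.\<close>

definition slide :: "nat \<Rightarrow> mat \<Rightarrow> mat" where
  "slide r x i k = (if Suc i < r then nxt x i k else lpp x i (Suc k) - lpp x i k)"

lemma row_eq_slide: "row_eq r s (shc 1 x) (slide r x)"
proof (cases r)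
  case 0
  then show ?thesis by (intro row_eq.agree) (simp add: agree_def)
next
  case (Suc n)
  \<comment> \<open>Any admissible \<open>q\<close> would give the same columns from 1 on; with
    column 0 of \<open>x\<close> itself the condition of \<open>row_eq_swp\<close> is an
    equality.\<close>
  have "row_eq r (Suc s) x (swp (\<lambda>i. x i 0) x n)"
    unfolding Suc by (rule row_eq_swp) simp
  then have "row_eq r s (shc 1 x) (shc 1 (swp (\<lambda>i. x i 0) x n))"
    by (rule row_eq_shc) simp
  moreover have "agree r s (shc 1 (swp (\<lambda>i. x i 0) x n)) (slide r x)"
    by (auto simp: agree_def slide_def Suc less_Suc_eq simp del: lpp.simps)
  ultimately show ?thesis by (blast intro: row_eq.intros)
qed

text \<open>The form of a fully swept matrix: \<open>q\<close> is column 0, \<open>v\<close> the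
  rest of the last row, and the remaining block is a smaller matrix, \<open>nxt x\<close> in the
  application.\<close>

definition emb :: "nat \<Rightarrow> (nat \<Rightarrow> real) \<Rightarrow> (nat \<Rightarrow> real) \<Rightarrow> mat \<Rightarrow> mat" where
  "emb r q v x i j = (case j of 0 \<Rightarrow> q i | Suc j \<Rightarrow> if i < r then x i j else v j)"

lemma emb_simps [simp]: "emb r q v x i 0 = q i"
  "emb r q v x i (Suc j) = (if i < r then x i j else v j)"
  by (simp_all add: emb_def)

text \<open>The threshold is chosen so that column 0 stays fixed and the carrier leaves it with load
  exactly \<open>th\<close>; both need \<open>q (Suc i) \<le> th\<close>.\<close>

lemma rowop_emb:
  assumes "Suc i < r" "q (Suc i) \<le> th"
  shows "rowop i (th - q (Suc i) + q i) (emb r q v x) = emb r q v (rowop i th x)"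
proof -
  have e: "rowst i (th - q (Suc i) + q i) (emb r q v x) (Suc k) = rowst i th x k" for k
    by (induction k) (use assms in auto)
  show ?thesis
  proof (intro ext)
    fix i' k
    show "rowop i (th - q (Suc i) + q i) (emb r q v x) i' k = emb r q v (rowop i th x) i' k"
      using assms e by (cases k) (auto simp: rowop_def simp del: rowst.simps(2))
  qed
qed

text \<open>A derivation of row equivalence uses finitely many thresholds; \<open>B\<close> is a
  lower bound for them, as \<open>rowop_emb\<close> demands.\<close>

lemma row_eq_emb:
  assumes "row_eq r s x z"
  shows "\<exists>B. \<forall>q v. (\<forall>i<r. q i \<le> B) \<longrightarrow> row_eq (Suc r) (Suc s) (emb r q v x) (emb r q v z)"
  using assms
proof induction
  case (agree x z)
  then have "agree (Suc r) (Suc s) (emb r q v x) (emb r q v z)" for q v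
    by (auto simp: agree_def emb_def split: nat.splits)
  then show ?case by (blast intro: row_eq.agree)
next
  case (op i x th)
  have "row_eq (Suc r) (Suc s) (emb r q v x) (emb r q v (rowop i th x))" if "\<forall>i<r. q i \<le> th" for q v
    using row_eq.op[of i "Suc r" "Suc s" "emb r q v x" "th - q (Suc i) + q i"] rowop_emb[of i r q th v x] op that
    by simp
  then show ?case by blast
next
  case (sym x z)
  then show ?case by (meson row_eq.sym)
next
  case (trans x y z)
  then obtain B1 B2 where
    "\<forall>q v. (\<forall>i<r. q i \<le> B1) \<longrightarrow> row_eq (Suc r) (Suc s) (emb r q v x) (emb r q v y)"
    "\<forall>q v. (\<forall>i<r. q i \<le> B2) \<longrightarrow> row_eq (Suc r) (Suc s) (emb r q v y) (emb r q v z)" by blast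
  then show ?case by (intro exI[of _ "min B1 B2"]) (metis min.boundedE row_eq.trans)
qed

lemma same_pr_nxt: "same_pr (Suc r) (Suc s) x z \<Longrightarrow> same_pr r s (nxt x) (nxt z)"
  unfolding same_pr_def pr_def
proof (intro allI impI)
  fix l j
  assume a: "\<forall>l j. l < Suc r \<longrightarrow> l + j < Suc s \<longrightarrow>
      lpp ((nxt ^^ l) x) (Suc r - 1 - l) j = lpp ((nxt ^^ l) z) (Suc r - 1 - l) j"
    and "l < r" "l + j < s"
  then show "lpp ((nxt ^^ l) (nxt x)) (r - 1 - l) j = lpp ((nxt ^^ l) (nxt z)) (r - 1 - l) j"
    using a[rule_format, of "Suc l" j] by (simp add: funpow_swap1)
qed

text \<open>After sweeping both matrices with the same very negative \<open>q\<close>, the last rows agree, and the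
  induction hypothesis for \<open>nxt\<close> connects the other rows.\<close>

theorem same_pr_imp_row_eq: "same_pr r s x z \<Longrightarrow> row_eq r s x z"
proof (induction r arbitrary: s x z)
  case 0
  then show ?case by (intro row_eq.agree) (simp add: agree_def)
next
  case (Suc r)
  show ?case
  proof (cases s)
    case 0
    then show ?thesis by (intro row_eq.agree) (simp add: agree_def)
  next
    case s: (Suc s')
    have last: "lpp x r j = lpp z r j" if "j < s" for j
      using Suc.prems that unfolding same_pr_def pr_def by force
    have "row_eq r s' (nxt x) (nxt z)"
      using Suc.prems unfolding s by (intro Suc.IH same_pr_nxt)
    then obtain B where
      B: "(\<forall>i<r. q i \<le> B) \<Longrightarrow> row_eq (Suc r) (Suc s') (emb r q v (nxt x)) (emb r q v (nxt z))" for q v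
      using row_eq_emb by blast
    \<comment> \<open>Below \<open>B\<close> for \<open>row_eq_emb\<close>, and below column 0 of
      both matrices so that both sweeps are admissible. The last entry, added in \<open>q'\<close>,
      is fixed by the sum of column 0; this sum is \<open>lpp\<close> at \<open>(r, 0)\<close> and
      thus the same for \<open>x\<close> and \<open>z\<close>.\<close>
    define q where "q i = min B (min (x i 0) (z i 0))" for i
    define q' where "q' i = (if i < r then q i else (\<Sum>i\<le>r. x i 0) - (\<Sum>i<r. q i))" for i
    define v where "v j = lpp x r (Suc j) - lpp x r j" for j
    have "row_eq (Suc r) s x (swp q x r)" "row_eq (Suc r) s z (swp q z r)"
      by (rule row_eq_swp, intro sum_mono, simp add: q_def)+
    moreover have "agree (Suc r) s (swp q x r) (emb r q' v (nxt x))"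
      unfolding agree_def
    proof (intro allI impI)
      fix i j assume "i < Suc r"
      then show "swp q x r i j = emb r q' v (nxt x) i j"
        by (cases j) (auto simp: q'_def v_def less_Suc_eq simp del: lpp.simps)
    qed
    moreover have "agree (Suc r) s (swp q z r) (emb r q' v (nxt z))"
      unfolding agree_def
    proof (intro allI impI)
      fix i j assume "i < Suc r" "j < s"
      moreover have "(\<Sum>i\<le>r. x i 0) = (\<Sum>i\<le>r. z i 0)"
        using last[of 0] by (simp add: lpp_col_0 s)
      ultimately show "swp q z r i j = emb r q' v (nxt z) i j"
        by (cases j) (auto simp: q'_def v_def less_Suc_eq last simp del: lpp.simps)
    qed
    moreover have "row_eq (Suc r) s (emb r q' v (nxt x)) (emb r q' v (nxt z))"
      unfolding s by (rule B) (simp add: q'_def q_def)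
    ultimately show ?thesis by (meson row_eq.agree row_eq.sym row_eq.trans)
  qed
qed

section \<open>Recovering a matrix from both halves of its pattern\<close>

lemma nxt_funpow_tr: "(nxt ^^ l) (tr x) = tr ((nxt ^^ l) x)"
  by (induction l) (simp_all add: nxt_tr del: tr_apply)

lemma lpp_inject:
  assumes "\<And>i j. i < r \<Longrightarrow> j < s \<Longrightarrow> lpp x i j = lpp z i j"
  shows "agree r s x z"
  unfolding agree_def
proof (intro allI impI)
  fix i j assume ij: "i < r" "j < s"
  show "x i j = z i j"
  proof (cases i; cases j)
    fix i' j' assume [simp]: "i = Suc i'" "j = Suc j'"
    show ?thesis using assms[of i j] assms[of i' j] assms[of i j'] ij by simp
  next
    fix i' assume [simp]: "i = Suc i'" "j = 0"
    show ?thesis using assms[of i j] assms[of i' j] ij by simp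
  next
    fix j' assume [simp]: "i = 0" "j = Suc j'"
    show ?thesis using assms[of i j] assms[of i j'] ij by simp
  next
    assume [simp]: "i = 0" "j = 0"
    show ?thesis using assms[of i j] ij by simp
  qed
qed

text \<open>This is the inverse of RSK: the halves supply the last row and the last column of
  \<open>lpp\<close>, the induction hypothesis supplies \<open>nxt\<close>, and the definition of
  \<open>nxt\<close>, solved for \<open>lpp x i j\<close>, fills in the rest from the far corner
  backwards.\<close>

theorem same_pr_unique:
  assumes "same_pr r s x z" "same_pr s r (tr x) (tr z)"
  shows "agree r s x z"
  using assms
proof (induction r arbitrary: s x z)
  case 0
  then show ?case by (simp add: agree_def)
next
  case (Suc r)
  show ?case
  proof (cases s)
    case 0
    then show ?thesis by (simp add: agree_def)
  next
    case s: (Suc s')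
    have N: "agree r s' (nxt x) (nxt z)"
    proof (rule Suc.IH)
      show "same_pr r s' (nxt x) (nxt z)"
        using Suc.prems by (intro same_pr_nxt) (simp add: s)
      show "same_pr s' r (tr (nxt x)) (tr (nxt z))"
        using Suc.prems by (fold nxt_tr, intro same_pr_nxt) (simp add: s del: tr_apply)
    qed
    have lr: "lpp x r j = lpp z r j" if "j < s" for j
      using Suc.prems(1) that unfolding same_pr_def pr_def by force
    have lc: "lpp x i s' = lpp z i s'" if "i < Suc r" for i
    proof -
      have "pr s (tr x) 0 i = pr s (tr z) 0 i"
        using Suc.prems(2) that unfolding same_pr_def by (simp add: s)
      then show ?thesis by (simp add: pr_def s lpp_tr del: tr_apply)
    qed
    have "lpp x i j = lpp z i j" if "i \<le> r" "j \<le> s'" for i j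
      using that
    proof (induction "(r - i) + (s' - j)" arbitrary: i j rule: less_induct)
      case less
      show ?case
      proof (cases "i = r \<or> j = s'")
        case True
        then show ?thesis using lr lc less.prems s by auto
      next
        case False
        then have ij: "i < r" "j < s'" using less.prems by auto
        have "lpp x (Suc i) j = lpp z (Suc i) j"
          using ij by (intro less.hyps) auto
        moreover have "lpp x i (Suc j) = lpp z i (Suc j)"
          using ij by (intro less.hyps) auto
        moreover have "nxt x i j = nxt z i j" using N ij by (simp add: agree_def)
        ultimately show ?thesis by (simp add: nxt_def del: lpp.simps)
      qed
    qed
    then show ?thesis by (intro lpp_inject) (simp add: s)
  qed
qed

lemma row_col_eq_unique:
  assumes "row_eq r s x z" "col_eq r s x z"
  shows "agree r s x z"
  using assms by (auto intro: same_pr_unique row_eq_imp_same_pr simp: col_eq_def simp del: tr_apply)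

text \<open>The two halves of the pattern share their main diagonal, so the last antidiagonal of one of
  them is redundant.\<close>

lemma row_col_eq_unique_diagonal:
  assumes "row_eq r (s - 1) x z" "col_eq r s x z"
  shows "agree r s x z"
proof (rule same_pr_unique)
  show 1: "same_pr s r (tr x) (tr z)"
    using assms(2) by (simp add: col_eq_def row_eq_imp_same_pr del: tr_apply)
  show "same_pr r s x z"
    unfolding same_pr_def
  proof (intro allI impI)
    fix l j assume lj: "l < r" "l + j < s"
    show "pr r x l j = pr r z l j"
    proof (cases "l + j < s - 1")
      case True
      then show ?thesis
        using row_eq_imp_same_pr[OF assms(1)] lj by (simp add: same_pr_def)
    next
      case False
      then have j: "j = s - 1 - l" using lj by auto
      have "pr s (tr x) l (r - 1 - l) = pr s (tr z) l (r - 1 - l)"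
        using 1 lj by (simp add: same_pr_def)
      then show ?thesis by (simp add: pr_def nxt_funpow_tr lpp_tr j del: tr_apply)
    qed
  qed
qed

text \<open>A row operation commutes with the column operations that generate the
  equivalence.\<close>

lemma col_eq_rowop:
  assumes "col_eq r s x z" "Suc i < r"
  shows "col_eq r s (rowop i th x) (rowop i th z)"
proof -
  have "row_eq s r X Z \<Longrightarrow> col_eq r s (rowop i th (tr X)) (rowop i th (tr Z))" for X Z
  proof (induction rule: row_eq.induct)
    case (agree X Z)
    then show ?case using assms(2)
      by (auto simp: col_eq_def agree_tr simp del: tr_apply intro!: row_eq.agree agree_rowop)
  next
    case (op j X f)
    have "rowop i th (tr (rowop j f X)) = tr (rowop j f (tr (rowop i th (tr X))))"
      using rowop_colop[of i th j f "tr X"] by (simp add: colop_def del: tr_apply)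
    then show ?case using op by (simp add: col_eq_def row_eq.op del: tr_apply)
  qed (auto simp: col_eq_def simp del: tr_apply intro: row_eq.sym row_eq.trans)
  from this[of "tr x" "tr z"] show ?thesis using assms by (simp add: col_eq_def del: tr_apply)
qed

lemma row_eq_colop:
  assumes "row_eq r s x z" "Suc j < s"
  shows "row_eq r s (colop j th x) (colop j th z)"
  using col_eq_rowop[of s r "tr x" "tr z" j th] assms by (simp add: col_eq_def colop_def del: tr_apply)

section \<open>Maps compatible with shifted row and column operations\<close>

text \<open>Each \<open>nxt\<close> reads one further row, so the exceptional last row of
  \<open>slide\<close> is not yet seen as long as \<open>i + l + 1 < r\<close>.\<close>

lemma slide_funpow:
  "Suc (i + l) < r \<Longrightarrow> (nxt ^^ l) (slide r x) i j = (nxt ^^ Suc l) x i j"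
proof (induction l arbitrary: i j)
  case 0
  then show ?case by (simp add: slide_def)
next
  case (Suc l)
  have "lpp ((nxt ^^ l) (slide r x)) i' j' = lpp ((nxt ^^ Suc l) x) i' j'" if "i' \<le> Suc i" for i' j'
    by (rule lpp_cong) (use Suc that in auto)
  then have "nxt ((nxt ^^ l) (slide r x)) i j = nxt ((nxt ^^ Suc l) x) i j"
    unfolding nxt_def[of "(nxt ^^ _) _"] by simp
  then show ?case by simp
qed

text \<open>In layer \<open>l\<close> this is the first row that sees the last row of
  \<open>slide\<close>: one neighbour in the definition of \<open>nxt\<close> belongs to the pattern
  of \<open>slide\<close>, the other values to the pattern of \<open>x\<close>.\<close>

lemma slide_funpow_last:
  assumes "l < r"
  shows "(nxt ^^ l) (slide r x) (r - 1 - l) j =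
    (if l = 0 then pr r x 0 (Suc j) else min (pr r (slide r x) (l - 1) j) (pr r x l (Suc j))) - pr r x l j"
proof (cases l)
  case 0
  then show ?thesis using assms by (simp add: slide_def pr_def)
next
  case (Suc m)
  have "lpp ((nxt ^^ m) (slide r x)) (r - 1 - l) j' = lpp ((nxt ^^ l) x) (r - 1 - l) j'" for j'
    unfolding Suc by (rule lpp_cong, rule slide_funpow) (use Suc assms in auto)
  moreover have "Suc (r - 1 - l) = r - 1 - m" using Suc assms by auto
  ultimately have "nxt ((nxt ^^ m) (slide r x)) (r - 1 - l) j = min (pr r (slide r x) m j) (pr r x l (Suc j)) - pr r x l j"
    unfolding nxt_def[of "(nxt ^^ m) _"] pr_def by simp
  then show ?thesis using Suc by simp
qed

text \<open>The recursion that the toggles of \<open>Pro\<^sup>P\<close> impose on this half of the pattern.\<close>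

definition promoted :: "nat \<Rightarrow> nat \<Rightarrow> mat \<Rightarrow> mat \<Rightarrow> bool" where
  "promoted r s x z \<longleftrightarrow> (\<forall>l j. l < r \<longrightarrow> l + j < s - 1 \<longrightarrow> pr r z l j =
     (if l = 0 then pr r x 0 (Suc j) else min (pr r z (l - 1) j) (pr r x l (Suc j)))
     + (if Suc l < r then (if j = 0 then pr r x (Suc l) 0 else max (pr r x (Suc l) j) (pr r z l (j - 1)))
        else (if j = 0 then 0 else pr r z l (j - 1)))
     - pr r x l j)"

text \<open>Unfold \<open>lpp\<close> once in row \<open>r - 1 - l\<close> of layer \<open>l\<close>
  of \<open>slide\<close>. The row above belongs to the pattern of \<open>x\<close>, the left
  neighbour to the new pattern, and the entry from \<open>slide_funpow_last\<close> is the upper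
  part of a toggle minus the old value.\<close>

lemma promoted_slide: "promoted r s x (slide r x)"
  unfolding promoted_def
proof (intro allI impI)
  fix l j assume l: "l < r" "l + j < s - 1"
  define n where "n = r - 1 - l"
  define y where "y = (nxt ^^ l) (slide r x)"
  have y: "lpp y n j = pr r (slide r x) l j" for j
    by (simp add: y_def n_def pr_def)
  note e = slide_funpow_last[OF l(1), of x j, folded n_def y_def]
  have above: "lpp y m j = pr r x (Suc l) j" if "n = Suc m" for m j
  proof -
    have "lpp y m j = lpp ((nxt ^^ Suc l) x) m j"
      unfolding y_def by (rule lpp_cong) (rule slide_funpow, use that n_def in auto)
    moreover have "m = r - 1 - Suc l" using that n_def by auto
    ultimately show ?thesis by (simp add: pr_def)
  qed
  show "pr r (slide r x) l j =
     (if l = 0 then pr r x 0 (Suc j) else min (pr r (slide r x) (l - 1) j) (pr r x l (Suc j)))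
     + (if Suc l < r then (if j = 0 then pr r x (Suc l) 0
          else max (pr r x (Suc l) j) (pr r (slide r x) l (j - 1)))
        else (if j = 0 then 0 else pr r (slide r x) l (j - 1)))
     - pr r x l j"
    unfolding y[symmetric, of j]
  proof (cases n; cases j)
    fix m k assume m: "n = Suc m" and k: "j = Suc k"
    have r: "Suc l < r" using m n_def by auto
    have "lpp y n j = max (lpp y m j) (lpp y n k) + y n j" by (simp add: m k)
    then show "lpp y n j = (if l = 0 then pr r x 0 (Suc j) else min (pr r (slide r x) (l - 1) j) (pr r x l (Suc j)))
     + (if Suc l < r then (if j = 0 then pr r x (Suc l) 0
          else max (pr r x (Suc l) j) (pr r (slide r x) l (j - 1)))
        else (if j = 0 then 0 else pr r (slide r x) l (j - 1)))
     - pr r x l j" unfolding e above[OF m] y using r k by simp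
  next
    fix m assume m: "n = Suc m" and k: "j = 0"
    have r: "Suc l < r" using m n_def by auto
    have "lpp y n j = lpp y m j + y n j" by (simp add: m k)
    then show "lpp y n j = (if l = 0 then pr r x 0 (Suc j) else min (pr r (slide r x) (l - 1) j) (pr r x l (Suc j)))
     + (if Suc l < r then (if j = 0 then pr r x (Suc l) 0
          else max (pr r x (Suc l) j) (pr r (slide r x) l (j - 1)))
        else (if j = 0 then 0 else pr r (slide r x) l (j - 1)))
     - pr r x l j" unfolding e above[OF m] using r k by simp
  next
    fix k assume m: "n = 0" and k: "j = Suc k"
    have r: "\<not> Suc l < r" using m n_def l by auto
    have "lpp y n j = lpp y n k + y n j" by (simp add: m k)
    then show "lpp y n j = (if l = 0 then pr r x 0 (Suc j) else min (pr r (slide r x) (l - 1) j) (pr r x l (Suc j)))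
     + (if Suc l < r then (if j = 0 then pr r x (Suc l) 0
          else max (pr r x (Suc l) j) (pr r (slide r x) l (j - 1)))
        else (if j = 0 then 0 else pr r (slide r x) l (j - 1)))
     - pr r x l j" unfolding e y using r k by simp
  next
    assume m: "n = 0" and k: "j = 0"
    have r: "\<not> Suc l < r" using m n_def l by auto
    have "lpp y n j = y n j" by (simp add: m k)
    then show "lpp y n j = (if l = 0 then pr r x 0 (Suc j) else min (pr r (slide r x) (l - 1) j) (pr r x l (Suc j)))
     + (if Suc l < r then (if j = 0 then pr r x (Suc l) 0
          else max (pr r x (Suc l) j) (pr r (slide r x) l (j - 1)))
        else (if j = 0 then 0 else pr r (slide r x) l (j - 1)))
     - pr r x l j" unfolding e using r k by simp
  qed
qed

lemma promoted_unique:
  assumes "promoted r s x y" "promoted r s x z"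
  shows "same_pr r (s - 1) y z"
proof -
  have "l < r \<Longrightarrow> l + j < s - 1 \<Longrightarrow> pr r y l j = pr r z l j" for l j
  proof (induction "l + j" arbitrary: l j rule: less_induct)
    case less
    have 1: "pr r y (l - 1) j = pr r z (l - 1) j" if "l \<noteq> 0"
      using that less.prems by (intro less.hyps) auto
    have 2: "pr r y l (j - 1) = pr r z l (j - 1)" if "j \<noteq> 0"
      using that less.prems by (intro less.hyps) auto
    show ?case
      by (subst assms(1)[unfolded promoted_def, rule_format, OF less.prems],
          subst assms(2)[unfolded promoted_def, rule_format, OF less.prems]) (use 1 2 in \<open>cases "l = 0"; cases "j = 0"; simp\<close>)
  qed
  then show ?thesis by (simp add: same_pr_def)
qed

text \<open>\<open>slide r x\<close> is one solution of the recursion and is known to be row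
  equivalent to the shifted matrix; uniqueness of the resulting pattern transfers this to every
  solution.\<close>

lemma promoted_imp_row_eq:
  assumes "promoted r s x z"
  shows "row_eq r (s - 1) (shc 1 x) z"
  using row_eq_slide same_pr_imp_row_eq[OF promoted_unique[OF promoted_slide assms]]
  by (rule row_eq.trans)

text \<open>\<open>di\<close> and \<open>dj\<close> are the distances by which boxes of type U and type D move.\<close>

definition psi_ok :: "nat \<Rightarrow> nat \<Rightarrow> nat \<Rightarrow> nat \<Rightarrow> (mat \<Rightarrow> mat) \<Rightarrow> bool" where
  "psi_ok r s di dj F \<longleftrightarrow>
    (\<forall>x z. agree r s x z \<longrightarrow> agree r s (F x) (F z)) \<and>
    (\<forall>x. row_eq r (s - dj) (shc dj x) (F x)) \<and>
    (\<forall>x. col_eq (r - di) s (shr di x) (F x)) \<and>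
    (\<forall>x i th. Suc (di + i) < r \<longrightarrow> agree r s (F (rowop (di + i) th x)) (rowop i th (F x))) \<and>
    (\<forall>x j th. Suc (dj + j) < s \<longrightarrow> agree r s (F (colop (dj + j) th x)) (colop j th (F x)))"

text \<open>Reduces \<open>ConjProQ\<close> to the argument for \<open>ConjProP\<close>, and the
  column half of \<open>crossing\<close> to the row half.\<close>

lemma psi_ok_tr:
  assumes "psi_ok r s di dj F"
  shows "psi_ok s r dj di (\<lambda>x. tr (F (tr x)))"
proof -
  have rowop_tr: "tr (rowop i th x) = colop i th (tr x)"
    and colop_tr: "tr (colop i th x) = rowop i th (tr x)" for i th x
    by (simp_all add: colop_def del: tr_apply)
  note F = assms[unfolded psi_ok_def]
  have "agree s r (tr (F (tr x))) (tr (F (tr z)))" if "agree s r x z" for x z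
    using F that by (simp add: agree_tr del: tr_apply)
  moreover have "row_eq s (r - di) (shc di x) (tr (F (tr x)))" for x
    using F[THEN conjunct2, THEN conjunct2, THEN conjunct1, rule_format, of "tr x"]
    unfolding col_eq_def tr_shr tr_tr .
  moreover have "col_eq (s - dj) r (shr dj x) (tr (F (tr x)))" for x
    using F[THEN conjunct2, THEN conjunct1, rule_format, of "tr x"]
    unfolding col_eq_def tr_shr tr_tr .
  moreover have "agree s r (tr (F (tr (rowop (dj + j) th x)))) (rowop j th (tr (F (tr x))))"
    if "Suc (dj + j) < s" for x j th
    unfolding rowop_tr colop_tr[symmetric] agree_tr using F that by blast
  moreover have "agree s r (tr (F (tr (colop (di + j) th x)))) (colop j th (tr (F (tr x))))"
    if "Suc (di + j) < r" for x j th
    unfolding colop_tr rowop_tr[symmetric] agree_tr using F that by blast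
  ultimately show ?thesis
    unfolding psi_ok_def by blast
qed

lemma shc_0 [simp]: "shc 0 x = x" and shr_0 [simp]: "shr 0 x = x"
  by (simp_all add: shc_def shr_def)

lemma shc_colop: "shc c (colop (c + j) th x) = colop j th (shc c x)"
proof -
  have "tr (shc c (colop (c + j) th x)) = tr (colop j th (shc c x))"
    unfolding tr_shc colop_def tr_tr shr_rowop by simp
  then show ?thesis by (metis tr_tr)
qed

text \<open>Compatibility with the operations comes from uniqueness alone: both sides of each
  equation are row equivalent on \<open>s - 1\<close> columns and column equivalent on the whole
  block.\<close>

lemma psi_ok_promotion:
  assumes loc: "\<And>x z. agree r s x z \<Longrightarrow> agree r s (F x) (F z)"
    and row: "\<And>x. row_eq r (s - 1) (shc 1 x) (F x)"
    and col: "\<And>x. col_eq r s x (F x)"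
  shows "psi_ok r s 0 1 F"
proof -
  have col_trans: "col_eq r s x y \<Longrightarrow> col_eq r s y z \<Longrightarrow> col_eq r s x z"
    and col_sym: "col_eq r s x y \<Longrightarrow> col_eq r s y x" for x y z
    unfolding col_eq_def by (blast intro: row_eq.trans row_eq.sym)+
  have "agree r s (F (rowop i th x)) (rowop i th (F x))" if i: "Suc i < r" for x i th
  proof (rule row_col_eq_unique_diagonal)
    have "row_eq r (s - 1) (shc 1 (rowop i th x)) (shc 1 x)"
      unfolding shc_rowop using i by (blast intro: row_eq.intros)
    moreover have "row_eq r (s - 1) (F x) (rowop i th (F x))"
      using i by (rule row_eq.op)
    ultimately show "row_eq r (s - 1) (F (rowop i th x)) (rowop i th (F x))"
      using row by (meson row_eq.trans row_eq.sym)
    show "col_eq r s (F (rowop i th x)) (rowop i th (F x))"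
      using col_trans[OF col_sym[OF col] col_eq_rowop[OF col i]] .
  qed
  moreover have "agree r s (F (colop (Suc j) th x)) (colop j th (F x))" if j: "Suc (Suc j) < s" for x j th
  proof (rule row_col_eq_unique_diagonal)
    have "row_eq r (s - 1) (F (colop (Suc j) th x)) (colop j th (shc 1 x))"
      using row[of "colop (Suc j) th x"] shc_colop[of 1 j th x] by (simp add: row_eq.sym)
    moreover have "row_eq r (s - 1) (colop j th (shc 1 x)) (colop j th (F x))"
      using j by (intro row_eq_colop row) simp
    ultimately show "row_eq r (s - 1) (F (colop (Suc j) th x)) (colop j th (F x))"
      by (rule row_eq.trans)
    have op: "col_eq r s z (colop j' th z)" if "Suc j' < s" for z j'
      unfolding col_eq_def colop_def tr_tr using that by (rule row_eq.op)
    show "col_eq r s (F (colop (Suc j) th x)) (colop j th (F x))"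
      using j by (meson col_trans col_sym col op Suc_lessD)
  qed
  ultimately show ?thesis
    unfolding psi_ok_def using loc row col by simp
qed

text \<open>The closed form of \<phi> \<circ> \<rho>^-1 \<circ> \<phi>^-1. The final transfer
  cancels the maximum over lower covers, leaving the minimum over upper covers of
  \<open>lpp x\<close> minus \<open>lpp x\<close>; the 1 in the corner is the empty minimum.\<close>

definition inv_row :: "nat \<Rightarrow> nat \<Rightarrow> mat \<Rightarrow> mat" where
  "inv_row r s x i j =
     (if Suc i < r then if Suc j < s then nxt x i j else lpp x (Suc i) j - lpp x i j
      else if Suc j < s then lpp x i (Suc j) - lpp x i j else 1 - lpp x i j)"

lemma inv_row_tr: "tr (inv_row s r (tr x)) = inv_row r s x"
  by (intro ext) (simp add: inv_row_def lpp_tr nxt_tr)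

lemma row_eq_inv_row: "row_eq r (s - 1) (shc 1 x) (inv_row r s x)"
proof -
  have "agree r (s - 1) (slide r x) (inv_row r s x)"
    by (auto simp: agree_def slide_def inv_row_def)
  then show ?thesis using row_eq_slide by (blast intro: row_eq.intros)
qed

text \<open>Away from the last column this is \<open>nxt_rowop_Suc\<close>. In the last column a
  difference of rows of \<open>lpp\<close> replaces \<open>nxt\<close>, and
  \<open>lpp_rowop_Suc\<close> applies directly; the carrier gets there through columns in which
  \<open>inv_row\<close> equals \<open>nxt\<close> in the rows concerned.\<close>

lemma inv_row_rowop:
  assumes i: "Suc (Suc i) < r"
  shows "agree r s (inv_row r s (rowop (Suc i) th x)) (rowop i th (inv_row r s x))"
  unfolding agree_def
proof (intro allI impI)
  fix i' j assume i': "i' < r" and j: "j < s"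
  have st: "rowst i th (inv_row r s x) k = rowst i th (nxt x) k" if "k < s" for k
    by (rule rowst_cong) (use i that in \<open>auto simp: inv_row_def\<close>)
  note * = lpp_rowop_Suc[of i th x j]
  consider "i' = i" | "i' = Suc i" | "i' \<noteq> i" "i' \<noteq> Suc i" by blast
  then show "inv_row r s (rowop (Suc i) th x) i' j = rowop i th (inv_row r s x) i' j"
  proof cases
    case 1
    show ?thesis
    proof (cases "Suc j < s")
      case True
      then show ?thesis using 1 i j by (simp add: inv_row_def nxt_rowop_Suc st)
    next
      case False
      have "lpp (rowop (Suc i) th x) (Suc i) j - lpp x i j = min (lpp x (Suc i) j - lpp x i j) (rowst i th (nxt x) j)"
        using * by (simp add: min_def)
      then show ?thesis using 1 i j False by (simp add: inv_row_def st lpp_rowop)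
    qed
  next
    case 2
    show ?thesis
    proof (cases "Suc j < s")
      case True
      then show ?thesis using 2 i j by (simp add: inv_row_def nxt_rowop_Suc st)
    next
      case False
      have "lpp x (Suc (Suc i)) j - lpp (rowop (Suc i) th x) (Suc i) j
        = lpp x (Suc (Suc i)) j - lpp x (Suc i) j + max 0 (lpp x (Suc i) j - lpp x i j - rowst i th (nxt x) j)"
        using * by (simp add: min_def max_def)
      then show ?thesis using 2 i j False by (simp add: inv_row_def st lpp_rowop)
    qed
  next
    case 3
    then show ?thesis using i i'
      by (auto simp: inv_row_def nxt_rowop_Suc lpp_rowop simp del: lpp.simps)
  qed
qed

lemma inv_row_cong: "agree r s x z \<Longrightarrow> agree r s (inv_row r s x) (inv_row r s z)"
  unfolding agree_def[of r s "inv_row r s x"] inv_row_def nxt_def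
  by (auto simp: agree_lpp simp del: lpp.simps)

lemma psi_ok_inv_row: "psi_ok r s 1 1 (inv_row r s)"
proof -
  have "col_eq (r - 1) s (shr 1 x) (inv_row r s x)" for x
    unfolding col_eq_def tr_shr inv_row_tr[of s r x, symmetric] tr_tr by (rule row_eq_inv_row)
  moreover have "agree r s (inv_row r s (colop (Suc j) th x)) (colop j th (inv_row r s x))"
    if "Suc (Suc j) < s" for x j th
    using inv_row_rowop[OF that, of r th "tr x"]
    unfolding colop_def inv_row_tr[of s r, symmetric] tr_tr agree_tr .
  ultimately show ?thesis
    unfolding psi_ok_def by (simp add: inv_row_cong row_eq_inv_row[simplified] inv_row_rowop)
qed

section \<open>Two matrices crossing in a common block\<close>

definition ins :: "nat \<Rightarrow> nat \<Rightarrow> mat \<Rightarrow> mat \<Rightarrow> mat" where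
  "ins a r x v i j = (if a \<le> i \<and> i < a + r then v (i - a) j else x i j)"

lemma ins_rowop:
  assumes "Suc i < r"
  shows "ins a r x (rowop i th v) = rowop (a + i) th (ins a r x v)"
proof -
  have st: "rowst (a + i) th (ins a r x v) k = rowst i th v k" for k
    by (induction k) (use assms in \<open>auto simp: ins_def\<close>)
  have "i' < a + i \<or> i' = a + i \<or> i' = Suc (a + i) \<or> i' > Suc (a + i)" for i' by auto
  then show ?thesis
    using assms by (intro ext) (auto simp: ins_def rowop_def st simp del: rowst.simps)
qed

text \<open>An operation inside the rows from \<open>a\<close> on passes through \<open>F\<close> as
  an operation \<open>di\<close> rows earlier with the same threshold. By induction on the
  equivalence, the change stays confined to the displaced rows.\<close>

lemma row_eq_psi:
  assumes F: "psi_ok r2 s2 di dj F" and "row_eq r s2 u v" and "a + r \<le> r2" "di \<le> a"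
  shows "(\<forall>i<r2. \<forall>j<s2. (i < a - di \<or> a - di + r \<le> i) \<longrightarrow> F (ins a r x u) i j = F (ins a r x v) i j)
     \<and> row_eq r s2 (shr (a - di) (F (ins a r x u))) (shr (a - di) (F (ins a r x v)))"
  using assms(2)
proof induction
  case (agree u v)
  then have "agree r2 s2 (ins a r x u) (ins a r x v)"
    by (auto simp: agree_def ins_def)
  then have "agree r2 s2 (F (ins a r x u)) (F (ins a r x v))"
    using F by (simp add: psi_ok_def)
  moreover from this have "agree r s2 (shr (a - di) (F (ins a r x u))) (shr (a - di) (F (ins a r x v)))"
    by (rule agree_shr) (use assms in auto)
  ultimately show ?case by (simp add: agree_def row_eq.agree)
next
  case (op i u th)
  define y where "y = ins a r x u"
  have "Suc (di + (a - di + i)) < r2" using op assms by auto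
  then have ag: "agree r2 s2 (F (rowop (a + i) th y)) (rowop (a - di + i) th (F y))"
    using F assms unfolding psi_ok_def by (metis add.assoc le_add_diff_inverse)
  have "agree r s2 (shr (a - di) (F (rowop (a + i) th y))) (rowop i th (shr (a - di) (F y)))"
    unfolding shr_rowop[symmetric] by (rule agree_shr[OF ag]) (use assms in auto)
  then have "row_eq r s2 (shr (a - di) (F y)) (shr (a - di) (F (rowop (a + i) th y)))"
    using op by (meson row_eq.intros)
  moreover have "F y i' j = F (rowop (a + i) th y) i' j" if "i' < r2" "j < s2" "i' < a - di \<or> a - di + r \<le> i'" for i' j
  proof -
    have "i' \<noteq> a - di + i" "i' \<noteq> Suc (a - di + i)" using that(3) op by auto
    then have "rowop (a - di + i) th (F y) i' j = F y i' j" by (rule rowop_simps)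
    then show ?thesis using ag that by (simp only: agree_def)
  qed
  ultimately show ?case unfolding ins_rowop[OF op] y_def by blast
qed (auto intro: row_eq.sym row_eq.trans)

lemma row_eq_window:
  assumes "psi_ok r s di dj F" "dj \<le> b" "b + s' \<le> s"
  shows "row_eq r s' (shc b x) (shc (b - dj) (F x))"
proof -
  have "row_eq r (s - dj) (shc dj x) (F x)" using assms by (simp add: psi_ok_def)
  then have "row_eq r s' (shc (b - dj) (shc dj x)) (shc (b - dj) (F x))"
    by (rule row_eq_shc) (use assms in auto)
  moreover have "shc (b - dj) (shc dj x) = shc b x"
    using assms(2) by (intro ext) simp
  ultimately show ?thesis by simp
qed

text \<open>\<open>y2\<close> is what \<open>F2\<close> finds after \<open>F1\<close> has acted: in
  the common rows, the window of \<open>F1 x1\<close> moved by \<open>dj1\<close> along with the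
  type D boxes. By \<open>row_eq_window\<close> it is row equivalent to the old one.\<close>

lemma crossing_half:
  assumes F1: "psi_ok r1 s1 di1 dj1 F1" and F2: "psi_ok r2 s2 di2 dj2 F2"
    and le: "a + r1 \<le> r2" "b + s2 \<le> s1" "dj1 \<le> b" "di2 \<le> a"
    and eq: "\<And>i j. i < r1 \<Longrightarrow> j < s2 \<Longrightarrow> x1 i (b + j) = x2 (a + i) j"
  defines "y2 \<equiv> ins a r1 x2 (shc (b - dj1) (F1 x1))"
  shows "i < r2 \<Longrightarrow> j < s2 \<Longrightarrow> i < a - di2 \<or> a - di2 + r1 \<le> i \<Longrightarrow> F2 y2 i j = F2 x2 i j"
    and "row_eq r1 s2 (shr (a - di2) (F2 x2)) (shr (a - di2) (F2 y2))"
proof -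
  let ?x = "ins a r1 x2 (shc b x1)"
  \<comment> \<open>\<open>x2\<close> is itself an insertion of the common block, so that
    \<open>row_eq_psi\<close> can compare it with \<open>y2\<close>.\<close>
  have "agree r2 s2 x2 ?x"
    unfolding agree_def ins_def
  proof (intro allI impI)
    fix i j assume "i < r2" "j < s2"
    then show "x2 i j = (if a \<le> i \<and> i < a + r1 then shc b x1 (i - a) j else x2 i j)"
      using eq[of "i - a" j] by auto
  qed
  then have ag: "agree r2 s2 (F2 x2) (F2 ?x)" using F2 by (simp add: psi_ok_def)
  have "row_eq r1 s2 (shc b x1) (shc (b - dj1) (F1 x1))"
    by (rule row_eq_window[OF F1]) (use assms in auto)
  note * = row_eq_psi[OF F2 this le(1,4), of x2, folded y2_def]
  show "i < r2 \<Longrightarrow> j < s2 \<Longrightarrow> i < a - di2 \<or> a - di2 + r1 \<le> i \<Longrightarrow> F2 y2 i j = F2 x2 i j"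
    using *[THEN conjunct1] ag[unfolded agree_def] by (metis (no_types, lifting))
  have "agree r1 s2 (shr (a - di2) (F2 x2)) (shr (a - di2) (F2 ?x))"
    by (rule agree_shr[OF ag]) (use assms in auto)
  then show "row_eq r1 s2 (shr (a - di2) (F2 x2)) (shr (a - di2) (F2 y2))"
    using * row_eq.agree row_eq.trans by blast
qed

lemma crossing:
  assumes F1: "psi_ok r1 s1 di1 dj1 F1" and F2: "psi_ok r2 s2 di2 dj2 F2"
    and le: "a + r1 \<le> r2" "b + s2 \<le> s1" "dj1 \<le> b" "di2 \<le> a"
    and eq: "\<And>i j. i < r1 \<Longrightarrow> j < s2 \<Longrightarrow> x1 i (b + j) = x2 (a + i) j"
  defines "y2 \<equiv> ins a r1 x2 (shc (b - dj1) (F1 x1))"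
    and "y1 \<equiv> tr (ins b s2 (tr x1) (tr (shr (a - di2) (F2 x2))))"
  shows "i < r2 \<Longrightarrow> j < s2 \<Longrightarrow> i < a - di2 \<or> a - di2 + r1 \<le> i \<Longrightarrow> F2 y2 i j = F2 x2 i j"
    and "i < r1 \<Longrightarrow> j < s1 \<Longrightarrow> j < b - dj1 \<or> b - dj1 + s2 \<le> j \<Longrightarrow> F1 y1 i j = F1 x1 i j"
    and "i < r1 \<Longrightarrow> j < s2 \<Longrightarrow> F2 y2 (a - di2 + i) j = F1 y1 i (b - dj1 + j)"
proof -
  note F1' = psi_ok_tr[OF F1] and F2' = psi_ok_tr[OF F2]
  have eq': "tr x2 j (a + i) = tr x1 (b + j) i" if "j < s2" "i < r1" for i j
    using eq that by simp
  note H1 = crossing_half[where ?x1.0 = x1 and ?x2.0 = x2, OF F1 F2 le eq, folded y2_def]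
  \<comment> \<open>The same statement for the transposed matrices, with the roles of the two maps
    exchanged.\<close>
  note H2 = crossing_half[where ?x1.0 = "tr x2" and ?x2.0 = "tr x1", OF F2' F1' le(2,1,4,3) eq', unfolded tr_tr tr_shr[symmetric], folded y1_def]
  show "i < r2 \<Longrightarrow> j < s2 \<Longrightarrow> i < a - di2 \<or> a - di2 + r1 \<le> i \<Longrightarrow> F2 y2 i j = F2 x2 i j"
    using H1(1) by blast
  show "i < r1 \<Longrightarrow> j < s1 \<Longrightarrow> j < b - dj1 \<or> b - dj1 + s2 \<le> j \<Longrightarrow> F1 y1 i j = F1 x1 i j"
    using H2(1)[of j i] by simp
  let ?z2 = "shr (a - di2) (F2 y2)" and ?z1 = "shc (b - dj1) (F1 y1)"
  have "agree r1 s2 ?z2 ?z1"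
  proof (rule row_col_eq_unique)
    have "agree r1 s2 (shc b y1) (shr (a - di2) (F2 x2))"
      by (simp add: agree_def y1_def ins_def)
    moreover have "row_eq r1 s2 (shc b y1) ?z1"
      by (rule row_eq_window[OF F1]) (use le in auto)
    ultimately show "row_eq r1 s2 ?z2 ?z1"
      using H1(2) by (meson row_eq.intros)
    have "agree s2 r1 (shc a (tr y2)) (tr (shc (b - dj1) (F1 x1)))"
      by (simp add: agree_def y2_def ins_def)
    moreover have "row_eq s2 r1 (shc a (tr y2)) (tr ?z2)"
      using row_eq_window[OF F2', of a r1 "tr y2"] le by (simp add: tr_shr del: tr_apply)
    moreover have "row_eq s2 r1 (tr (shc (b - dj1) (F1 x1))) (tr ?z1)"
      using H2(2) unfolding tr_shc .
    ultimately show "col_eq r1 s2 ?z2 ?z1"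
      unfolding col_eq_def by (meson row_eq.intros)
  qed
  then show "i < r1 \<Longrightarrow> j < s2 \<Longrightarrow> F2 y2 (a - di2 + i) j = F1 y1 i (b - dj1 + j)"
    by (simp add: agree_def)
qed

section \<open>Toggles, RSK and promotion in matrix form\<close>

text \<open>Matrices are indexed from 0, boxes of \<open>[r] \<times> [s]\<close> from 1.\<close>

definition bx :: "nat \<Rightarrow> nat \<Rightarrow> box" where
  "bx i j = (int i + 1, int j + 1)"

definition mat_of :: "labeling \<Rightarrow> mat" where
  "mat_of x i j = x (bx i j)"

definition lab_of :: "mat \<Rightarrow> labeling" where
  "lab_of X = (\<lambda>(a, b). X (nat (a - 1)) (nat (b - 1)))"

lemma mat_of_lab_of [simp]: "mat_of (lab_of X) = X"
  by (intro ext) (simp add: mat_of_def lab_of_def bx_def)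

lemma bx_in_grid [simp]: "bx i j \<in> grid (int r) (int s) \<longleftrightarrow> i < r \<and> j < s"
  by (auto simp: bx_def grid_def)

lemma grid_bx: "p \<in> grid (int r) (int s) \<Longrightarrow> \<exists>i<r. \<exists>j<s. p = bx i j"
  by (rule exI[of _ "nat (fst p - 1)"], auto simp: grid_def bx_def, rule exI[of _ "nat (snd p - 1)"], auto)

section \<open>Covers, toggles and rowmotion\<close>

lemma covered_by_iff:
  "covered_by r s (a, b) (c, d) \<longleftrightarrow> (a, b) \<in> grid r s \<and> (c, d) \<in> grid r s \<and>
     (c = a + 1 \<and> d = b \<or> c = a \<and> d = b + 1)"
proof
  assume cov: "covered_by r s (a, b) (c, d)"
  then have g: "(a, b) \<in> grid r s" "(c, d) \<in> grid r s" and lt: "a \<le> c" "b \<le> d" "a < c \<or> b < d"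
    by (auto simp: covered_by_def less_le)
  have no: "\<not> ((a, b) < z \<and> z < (c, d))" if "z \<in> grid r s" for z
    using cov that by (auto simp: covered_by_def)
  consider "a < c" "b < d" | "a < c" "b = d" | "a = c" "b < d" using lt by linarith
  then show "(a, b) \<in> grid r s \<and> (c, d) \<in> grid r s \<and> (c = a + 1 \<and> d = b \<or> c = a \<and> d = b + 1)"
  proof cases
    case 1
    then show ?thesis using no[of "(a + 1, b)"] g by (auto simp: grid_def less_le)
  next
    case 2
    then show ?thesis using no[of "(a + 1, b)"] g by (auto simp: grid_def less_le)
  next
    case 3
    then show ?thesis using no[of "(a, b + 1)"] g by (auto simp: grid_def less_le)
  qed
next
  assume "(a, b) \<in> grid r s \<and> (c, d) \<in> grid r s \<and> (c = a + 1 \<and> d = b \<or> c = a \<and> d = b + 1)"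
  then show "covered_by r s (a, b) (c, d)"
    by (auto simp: covered_by_def less_le)
qed

definition dnm :: "mat \<Rightarrow> mat" where
  "dnm X i j = (if i = 0 then if j = 0 then 0 else X 0 (j - 1)
     else if j = 0 then X (i - 1) 0 else max (X (i - 1) j) (X i (j - 1)))"

definition upm :: "nat \<Rightarrow> nat \<Rightarrow> mat \<Rightarrow> mat" where
  "upm r s X i j = (if Suc i < r then if Suc j < s then min (X (Suc i) j) (X i (Suc j)) else X (Suc i) j
     else if Suc j < s then X i (Suc j) else 1)"

lemma lower_covers:
  assumes "i < r" "j < s"
  shows "{q. covered_by (int r) (int s) q (bx i j)}
     = (if i = 0 then {} else {bx (i - 1) j}) \<union> (if j = 0 then {} else {bx i (j - 1)})"
  using assms by (auto simp: covered_by_iff bx_def grid_def)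

lemma upper_covers:
  assumes "i < r" "j < s"
  shows "{q. covered_by (int r) (int s) (bx i j) q}
     = (if Suc i < r then {bx (Suc i) j} else {}) \<union> (if Suc j < s then {bx i (Suc j)} else {})"
  using assms by (auto simp: covered_by_iff bx_def grid_def)

lemma max0_lower:
  "i < r \<Longrightarrow> j < s \<Longrightarrow> max0 (x ` {q. covered_by (int r) (int s) q (bx i j)}) = dnm (mat_of x) i j"
  unfolding lower_covers by (auto simp: max0_def dnm_def mat_of_def)

lemma min1_upper:
  "i < r \<Longrightarrow> j < s \<Longrightarrow> min1 (x ` {q. covered_by (int r) (int s) (bx i j) q}) = upm r s (mat_of x) i j"
  unfolding upper_covers by (auto simp: min1_def upm_def mat_of_def)

lemma toggle_toggle: "toggle r s p (toggle r s p x) = x"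
proof -
  have *: "toggle r s p x ` A = x ` A" if "p \<notin> A" for A
    by (rule image_cong) (use that in \<open>auto simp: toggle_def\<close>)
  have "p \<notin> {q. covered_by r s p q}" "p \<notin> {q. covered_by r s q p}"
    by (auto simp: covered_by_def)
  then show ?thesis
    by (subst toggle_def, simp only: *) (simp add: toggle_def)
qed

text \<open>\<open>foldr\<close> toggles the end of the list first. When \<open>p\<close> is
  toggled, its upper covers thus carry their final labels and its lower covers still their initial
  ones. The equation no longer mentions the order of the list.\<close>

lemma foldr_toggle:
  fixes r s :: int and x :: labeling
  assumes "distinct ps" "sorted_wrt (\<lambda>p q. \<not> q < p) ps"
  defines "y \<equiv> foldr (toggle r s) ps x"
  shows "(\<forall>p. p \<notin> set ps \<longrightarrow> y p = x p) \<and> (\<forall>p\<in>set ps. y p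
     = min1 (y ` {q. covered_by r s p q}) + max0 (x ` {q. covered_by r s q p}) - x p)"
  unfolding y_def using assms(1,2)
proof (induction ps)
  case (Cons a ps)
  define y where "y = foldr (toggle r s) ps x"
  define z where "z = toggle r s a y"
  have "distinct ps" "sorted_wrt (\<lambda>p q. \<not> q < p) ps" using Cons.prems by auto
  note IH = Cons.IH[OF this, folded y_def]
  note out = IH[THEN conjunct1, rule_format]
  have eq: "y p = min1 (y ` {q. covered_by r s p q}) + max0 (x ` {q. covered_by r s q p}) - x p"
    if "p \<in> set ps" for p using IH[THEN conjunct2] that by (rule bspec)
  have z: "z p = y p" if "p \<noteq> a" for p using that by (simp add: z_def toggle_def)
  have up: "z ` {q. covered_by r s p q} = y ` {q. covered_by r s p q}" if "p = a \<or> p \<in> set ps" for p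
  proof (rule image_cong)
    fix q assume q: "q \<in> {q. covered_by r s p q}"
    show "z q = y q" by (rule z) (use q that Cons.prems in \<open>auto simp: covered_by_def\<close>)
  qed simp
  have dn: "y ` {q. covered_by r s q a} = x ` {q. covered_by r s q a}"
  proof (rule image_cong)
    fix q assume q: "q \<in> {q. covered_by r s q a}"
    show "y q = x q" by (rule out) (use q Cons.prems in \<open>auto simp: covered_by_def\<close>)
  qed simp
  have "z p = min1 (z ` {q. covered_by r s p q}) + max0 (x ` {q. covered_by r s q p}) - x p"
    if "p \<in> set (a # ps)" for p
  proof (cases "p = a")
    case True
    have "z a = min1 (y ` {q. covered_by r s a q}) + max0 (y ` {q. covered_by r s q a}) - y a"
      by (simp add: z_def toggle_def)
    then show ?thesis using True up[of a] dn out[of a] Cons.prems by simp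
  next
    case False
    then show ?thesis using that z[of p] eq[of p] up[of p] by simp
  qed
  moreover have "z p = x p" if "p \<notin> set (a # ps)" for p
    using that z[of p] out[of p] by simp
  moreover have "foldr (toggle r s) (a # ps) x = z" by (simp add: z_def y_def)
  ultimately show ?case by blast
qed simp

text \<open>Needed because \<open>rho\<close> picks a linear extension by \<open>SOME\<close>; a
  maximal element receives the largest number.\<close>

lemma linear_extension_exists: "finite I \<Longrightarrow> \<exists>L. linear_extension I L"
proof (induction "card I" arbitrary: I)
  case 0
  then show ?case by (auto simp: linear_extension_def bij_betw_def)
next
  case (Suc n)
  then have "I \<noteq> {}" by auto
  then obtain m where m: "m \<in> I" "\<And>q. q \<in> I \<Longrightarrow> m \<le> q \<Longrightarrow> m = q"
    using finite_has_maximal[OF Suc.prems] by blast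
  have n: "card (I - {m}) = n" "card I = Suc n" using Suc m by auto
  then obtain L where L: "linear_extension (I - {m}) L" using Suc by blast
  then have bij: "bij_betw L (I - {m}) {1..n}" by (simp add: linear_extension_def n)
  then have "bij_betw (L(m := Suc n)) (I - {m}) {1..n}"
    by (rule bij_betw_cong[THEN iffD1, rotated]) auto
  then have "bij_betw (L(m := Suc n)) (I - {m} \<union> {m}) ({1..n} \<union> {Suc n})"
    by (rule bij_betw_combine) auto
  moreover have "I - {m} \<union> {m} = I" "{1..n} \<union> {Suc n} = {1..card I}" using m n by auto
  ultimately have "bij_betw (L(m := Suc n)) I {1..card I}" by simp
  moreover have "(L(m := Suc n)) p \<le> (L(m := Suc n)) q" if "p \<in> I" "q \<in> I" "p \<le> q" for p q
  proof (cases "p = m")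
    case True
    then have "q = m" using m(2)[of q] that by simp
    then show ?thesis using True by simp
  next
    case False
    then have "L p \<le> n" using bij that by (auto dest!: bij_betwE)
    then show ?thesis using L False that by (auto simp: linear_extension_def)
  qed
  ultimately have "linear_extension I (L(m := Suc n))"
    unfolding linear_extension_def by blast
  then show ?case by blast
qed

lemma rho_as_foldr:
  assumes "finite I"
  obtains ps where "distinct ps" "set ps = I" "sorted_wrt (\<lambda>p q. \<not> q < p) ps"
    "rho r s I = foldr (toggle r s) ps"
proof -
  define L where "L = (SOME L. linear_extension I L)"
  have L: "linear_extension I L"
    unfolding L_def using linear_extension_exists[OF assms] by (rule someI_ex)
  then have bij: "bij_betw L I {1..card I}" by (simp add: linear_extension_def)
  have bij': "bij_betw (inv_into I L) {1..card I} I" by (rule bij_betw_inv_into[OF bij])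
  let ?ps = "map (inv_into I L) [1..<Suc (card I)]"
  have set: "set [1..<Suc (card I)] = {1..card I}" by auto
  have "distinct ?ps"
    unfolding distinct_map set using bij' by (simp add: bij_betw_def)
  moreover have "set ?ps = I"
    unfolding set_map set using bij' by (simp add: bij_betw_def)
  moreover have "sorted_wrt (\<lambda>p q. \<not> q < p) ?ps"
    unfolding sorted_wrt_map
  proof (rule sorted_wrt_mono_rel[OF _ sorted_wrt_upt])
    fix a b assume ab: "a \<in> set [1..<Suc (card I)]" "b \<in> set [1..<Suc (card I)]" "a < b"
    show "\<not> inv_into I L b < inv_into I L a"
    proof
      assume lt: "inv_into I L b < inv_into I L a"
      have "inv_into I L a \<in> I" "inv_into I L b \<in> I"
        using bij' ab unfolding set by (auto dest: bij_betwE)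
      then have "L (inv_into I L b) \<le> L (inv_into I L a)"
        using L lt by (simp add: linear_extension_def)
      moreover have "L (inv_into I L a) = a" "L (inv_into I L b) = b"
        using bij ab unfolding set by (auto intro: bij_betw_inv_into_right)
      ultimately show False using ab by simp
    qed
  qed
  ultimately show ?thesis using that[of ?ps] by (simp add: rho_def L_def Let_def del: upt_Suc)
qed

lemma foldr_toggle_bij: "bij (foldr (toggle r s) ps)"
proof (induction ps)
  case (Cons a ps)
  have "bij (toggle r s a)" by (rule involuntory_imp_bij) (rule toggle_toggle)
  from bij_comp[OF Cons this] show ?case unfolding foldr.simps .
qed (unfold foldr.simps, rule bij_id)

lemma finite_grid [simp]: "finite (grid r s)"
  by (simp add: grid_def)

lemma bij_rho: "finite I \<Longrightarrow> bij (rho r s I)"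
  using rho_as_foldr[of I r s] foldr_toggle_bij[of r s] by metis

lemma rho_outside:
  assumes "finite I" "p \<notin> I"
  shows "rho r s I x p = x p"
proof -
  obtain ps where ps: "distinct ps" "set ps = I" "sorted_wrt (\<lambda>p q. \<not> q < p) ps"
    "rho r s I = foldr (toggle r s) ps" using rho_as_foldr[OF assms(1)] .
  then show ?thesis
    using foldr_toggle[OF ps(1,3), of r s x, THEN conjunct1, rule_format, of p] assms(2) by simp
qed

lemma rho_inside:
  fixes x :: labeling
  assumes "finite I" "bx i j \<in> I" "i < r" "j < s"
  defines "y \<equiv> rho (int r) (int s) I x"
  shows "mat_of y i j = upm r s (mat_of y) i j + dnm (mat_of x) i j - mat_of x i j"
proof -
  obtain ps where ps: "distinct ps" "set ps = I" "sorted_wrt (\<lambda>p q. \<not> q < p) ps"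
    "rho (int r) (int s) I = foldr (toggle (int r) (int s)) ps" using rho_as_foldr[OF assms(1)] .
  then show ?thesis
    using foldr_toggle[OF ps(1,3), of "int r" "int s" x, THEN conjunct2, rule_format, of "bx i j"] assms
    by (simp add: max0_lower min1_upper mat_of_def[of _ i j])
qed

section \<open>Transfer map, inverse rowmotion and RSK\<close>

lemma lpp_dnm: "lpp X i j = dnm (lpp X) i j + X i j"
  by (cases i; cases j) (auto simp: dnm_def)

lemma dnm_cong:
  "(\<And>i' j'. i' + j' < i + j \<Longrightarrow> i' \<le> i \<Longrightarrow> j' \<le> j \<Longrightarrow> X i' j' = Z i' j') \<Longrightarrow> dnm X i j = dnm Z i j"
  by (simp add: dnm_def)

text \<open>The recursion determines \<open>Y\<close> from the bottom up. It identifies the inverse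
  transfer map, and later each round of RSK, with an \<open>lpp\<close>.\<close>

lemma lpp_from_dnm:
  assumes "\<And>i j. i < r \<Longrightarrow> j < s \<Longrightarrow> Y i j = dnm Y i j + X i j" "i < r" "j < s"
  shows "Y i j = lpp X i j"
  using assms(2,3)
proof (induction "i + j" arbitrary: i j rule: less_induct)
  case less
  have "dnm Y i j = dnm (lpp X) i j" by (rule dnm_cong) (use less in auto)
  then show ?case using assms(1)[OF less.prems] lpp_dnm[of X i j] by simp
qed

lemma transfer_inside:
  "i < r \<Longrightarrow> j < s \<Longrightarrow> mat_of (transfer (int r) (int s) x) i j = mat_of x i j - dnm (mat_of x) i j"
  by (simp add: mat_of_def[of _ i j] transfer_def max0_lower)

lemma bij_transfer: "bij (transfer (int r) (int s))"
proof (rule o_bij)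
  define T where "T x = (\<lambda>p. if p \<in> grid (int r) (int s) then lab_of (lpp (mat_of x)) p else x p)" for x
  have T: "mat_of (T x) i j = lpp (mat_of x) i j" if "i < r" "j < s" for x i j
    using that unfolding mat_of_def[of "T x"] unfolding T_def
    by simp (simp add: lab_of_def bx_def)
  show "T \<circ> transfer (int r) (int s) = id"
  proof (intro ext)
    fix x :: labeling and p
    show "(T \<circ> transfer (int r) (int s)) x p = id x p"
    proof (cases "p \<in> grid (int r) (int s)")
      case True
      then obtain i j where ij: "i < r" "j < s" "p = bx i j" using grid_bx by blast
      have "mat_of x i j = lpp (mat_of (transfer (int r) (int s) x)) i j"
        by (rule lpp_from_dnm) (use ij transfer_inside in auto)
      then show ?thesis using T[OF ij(1,2)] ij by (simp add: mat_of_def)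
    qed (simp add: T_def transfer_def)
  qed
  show "transfer (int r) (int s) \<circ> T = id"
  proof (intro ext)
    fix x :: labeling and p
    show "(transfer (int r) (int s) \<circ> T) x p = id x p"
    proof (cases "p \<in> grid (int r) (int s)")
      case True
      then obtain i j where ij: "i < r" "j < s" "p = bx i j" using grid_bx by blast
      have "dnm (mat_of (T x)) i j = dnm (lpp (mat_of x)) i j"
        by (rule dnm_cong) (use ij T in auto)
      then have "mat_of (transfer (int r) (int s) (T x)) i j = mat_of x i j"
        using lpp_dnm[of "mat_of x" i j] ij by (simp add: transfer_inside T)
      then show ?thesis by (simp add: mat_of_def ij)
    qed (simp add: T_def transfer_def)
  qed
qed

lemma inv_transfer_inside:
  assumes "i < r" "j < s"
  shows "mat_of (inv (transfer (int r) (int s)) x) i j = lpp (mat_of x) i j"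
proof (rule lpp_from_dnm[OF _ assms])
  fix i j assume ij: "i < r" "j < s"
  have "transfer (int r) (int s) (inv (transfer (int r) (int s)) x) = x"
    using bij_transfer by (simp add: bij_is_surj surj_f_inv_f)
  then show "mat_of (inv (transfer (int r) (int s)) x) i j
      = dnm (mat_of (inv (transfer (int r) (int s)) x)) i j + mat_of x i j"
    using transfer_inside[OF ij, of "inv (transfer (int r) (int s)) x"] by simp
qed

lemma inv_rho_inside:
  fixes x :: labeling
  assumes "finite I" "bx i j \<in> I" "i < r" "j < s"
  defines "y \<equiv> inv (rho (int r) (int s) I) x"
  shows "mat_of y i j = upm r s (mat_of x) i j + dnm (mat_of y) i j - mat_of x i j"
proof -
  have "rho (int r) (int s) I y = x"
    unfolding y_def using bij_rho[OF assms(1)] by (simp add: bij_is_surj surj_f_inv_f)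
  then show ?thesis using rho_inside[OF assms(1-4), of y] by simp
qed

lemma inv_rho_outside:
  assumes "finite I" "p \<notin> I"
  shows "inv (rho r s I) x p = x p"
proof -
  have "rho r s I (inv (rho r s I) x) = x"
    using bij_rho[OF assms(1)] by (simp add: bij_is_surj surj_f_inv_f)
  then show ?thesis using rho_outside[OF assms, of r s "inv (rho r s I) x"] by simp
qed

lemma psi_ConjRowInv:
  assumes "i < r" "j < s"
  shows "mat_of (psi ConjRowInv (int r) (int s) x) i j = inv_row r s (mat_of x) i j"
proof -
  define u where "u = inv (transfer (int r) (int s)) x"
  define v where "v = inv (rho (int r) (int s) (grid (int r) (int s))) u"
  have U: "mat_of u i j = lpp (mat_of x) i j" if "i < r" "j < s" for i j
    unfolding u_def by (rule inv_transfer_inside[OF that])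
  have "mat_of v i j = upm r s (mat_of u) i j + dnm (mat_of v) i j - mat_of u i j"
    unfolding v_def by (rule inv_rho_inside) (use assms in auto)
  then have "mat_of (transfer (int r) (int s) v) i j = upm r s (mat_of u) i j - mat_of u i j"
    by (simp add: transfer_inside assms)
  also have "\<dots> = inv_row r s (mat_of x) i j"
    using assms by (auto simp: upm_def inv_row_def nxt_def U simp del: lpp.simps)
  finally show ?thesis by (simp add: u_def v_def)
qed

text \<open>The closed form of RSK. The box at \<open>(i, j)\<close> lies in the grid of round
  \<open>k\<close> exactly for \<open>1 \<le> k \<le> min (r - 1 - i) (s - 1 - j)\<close>, and each
  such round passes to the next layer.\<close>

definition rskm :: "nat \<Rightarrow> nat \<Rightarrow> mat \<Rightarrow> mat" where
  "rskm r s X i j = lpp ((nxt ^^ min (r - 1 - i) (s - 1 - j)) X) i j"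

text \<open>A box toggled in round \<open>k + 1\<close> and its upper neighbours were all toggled in
  the \<open>k\<close> rounds before. Their labels are \<open>lpp\<close> of layer \<open>k\<close>,
  so the upper minimum minus the old label is an entry of layer \<open>k + 1\<close>.\<close>

lemma RSK_step:
  fixes y :: labeling
  assumes Y: "\<And>i j. i < r \<Longrightarrow> j < s \<Longrightarrow>
      mat_of y i j = lpp ((nxt ^^ min k (min (r - 1 - i) (s - 1 - j))) X) i j"
    and "i < r" "j < s"
  defines "z \<equiv> inv (rho (int r) (int s) (grid (int r - int (Suc k)) (int s - int (Suc k)))) y"
  shows "mat_of z i j = lpp ((nxt ^^ min (Suc k) (min (r - 1 - i) (s - 1 - j))) X) i j"
proof (cases "i + Suc k < r \<and> j + Suc k < s")
  case True
  have "mat_of z i j = lpp ((nxt ^^ Suc k) X) i j"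
  proof (rule lpp_from_dnm[where r = "r - Suc k" and s = "s - Suc k"])
    fix i j assume ij: "i < r - Suc k" "j < s - Suc k"
    then have "bx i j \<in> grid (int r - int (Suc k)) (int s - int (Suc k))"
      by (auto simp: bx_def grid_def)
    then have "mat_of z i j = upm r s (mat_of y) i j + dnm (mat_of z) i j - mat_of y i j"
      unfolding z_def using ij by (intro inv_rho_inside) auto
    moreover have "upm r s (mat_of y) i j - mat_of y i j = nxt ((nxt ^^ k) X) i j"
    proof -
      have "mat_of y i' j' = lpp ((nxt ^^ k) X) i' j'" if "i' \<le> Suc i" "j' \<le> Suc j" for i' j'
      proof -
        have "min k (min (r - 1 - i') (s - 1 - j')) = k" using that ij by auto
        then show ?thesis using Y[of i' j'] that ij by simp
      qed
      moreover have "Suc i < r" "Suc j < s" using ij by auto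
      ultimately show ?thesis
        unfolding nxt_def[of "(nxt ^^ k) X"] by (simp add: upm_def del: lpp.simps)
    qed
    ultimately show "mat_of z i j = dnm (mat_of z) i j + (nxt ^^ Suc k) X i j" by simp
  qed (use True in auto)
  moreover have "min (Suc k) (min (r - 1 - i) (s - 1 - j)) = Suc k" using True by auto
  ultimately show ?thesis by (simp only:)
next
  case False
  then have "bx i j \<notin> grid (int r - int (Suc k)) (int s - int (Suc k))"
    by (auto simp: bx_def grid_def)
  then have "mat_of z i j = mat_of y i j"
    by (simp add: z_def mat_of_def inv_rho_outside)
  moreover have "min (Suc k) (min (r - 1 - i) (s - 1 - j)) = min k (min (r - 1 - i) (s - 1 - j))"
    using False assms by auto
  ultimately show ?thesis using Y[OF assms(2,3)] by simp
qed

lemma RSK_inside: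
  assumes "i < r" "j < s"
  shows "mat_of (RSK (int r) (int s) x) i j = rskm r s (mat_of x) i j"
proof -
  define f where "f k = inv (rho (int r) (int s) (grid (int r - k) (int s - k)))" for k
  have fold: "mat_of (fold f [1..int k] (inv (transfer (int r) (int s)) x)) i j
      = lpp ((nxt ^^ min k (min (r - 1 - i) (s - 1 - j))) (mat_of x)) i j" if "i < r" "j < s" for k i j
    using that
  proof (induction k arbitrary: i j)
    case 0
    then show ?case by (simp add: inv_transfer_inside)
  next
    case (Suc k)
    have "[1..int (Suc k)] = [1..int k] @ [int (Suc k)]"
      using upto_rec2[of 1 "int (Suc k)"] by simp
    then have *: "fold f [1..int (Suc k)] u = f (int (Suc k)) (fold f [1..int k] u)" for u by simp
    show ?case
      unfolding * f_def[of "int (Suc k)"] by (rule RSK_step[OF Suc.IH Suc.prems])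
  qed
  have f_abs: "(\<lambda>k. inv (rho (int r) (int s) (grid (int r - k) (int s - k)))) = f"
    by (rule ext) (simp add: f_def)
  have m: "min (int r) (int s) - 1 = int (min r s - 1)" using assms by auto
  have "min (min r s - 1) (min (r - 1 - i) (s - 1 - j)) = min (r - 1 - i) (s - 1 - j)" by auto
  then show ?thesis
    using fold[OF assms, of "min r s - 1"] unfolding RSK_def m f_abs comp_apply rskm_def by simp
qed

lemma bij_fold: "(\<And>k. k \<in> set ks \<Longrightarrow> bij (f k)) \<Longrightarrow> bij (fold f ks)"
proof (induction ks)
  case (Cons k ks)
  then have "bij (fold f ks \<circ> f k)" by (intro bij_comp) simp_all
  then show ?case unfolding fold.simps .
qed (unfold fold.simps, rule bij_id)

lemma bij_RSK: "bij (RSK (int r) (int s))"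
  unfolding RSK_def by (intro bij_comp bij_fold bij_imp_bij_inv bij_transfer bij_rho) simp

text \<open>Covers of a box lie on the two neighbouring file diagonals, never on its own.\<close>

lemma upm_dnm_cong:
  assumes "\<And>i' j'. int i' - int j' \<noteq> int i - int j \<Longrightarrow> X i' j' = Z i' j'"
  shows "upm r s X i j = upm r s Z i j" "dnm X i j = dnm Z i j"
proof -
  have "X (Suc i) j = Z (Suc i) j" "X i (Suc j) = Z i (Suc j)" by (auto intro: assms)
  then show "upm r s X i j = upm r s Z i j" by (simp add: upm_def)
  have "i \<noteq> 0 \<Longrightarrow> X (i - 1) j = Z (i - 1) j" "j \<noteq> 0 \<Longrightarrow> X i (j - 1) = Z i (j - 1)"
    by (auto intro: assms)
  then show "dnm X i j = dnm Z i j" by (auto simp: dnm_def)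
qed

lemma bx_in_file_diagonal [simp]:
  "bx i j \<in> file_diagonal (int r) (int s) k \<longleftrightarrow> i < r \<and> j < s \<and> int i - int j = k"
  by (auto simp: file_diagonal_def bx_def grid_def)

lemma finite_file_diagonal [simp]: "finite (file_diagonal r s k)"
  by (rule finite_subset[OF _ finite_grid[of r s]]) (auto simp: file_diagonal_def)

text \<open>\<open>R k k'\<close> says that the file diagonal \<open>k'\<close> is toggled before \<open>k\<close>; it is \<open><\<close> for \<open>ProP\<close> and \<open>>\<close> for
  \<open>ProQ\<close>.\<close>

lemma foldr_rho_file_diagonals:
  fixes R :: "int \<Rightarrow> int \<Rightarrow> bool" and x :: labeling and r s :: nat
  assumes "sorted_wrt R ks" and asym: "\<And>a b. R a b \<Longrightarrow> \<not> R b a"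
  defines "y \<equiv> foldr (\<lambda>k. rho (int r) (int s) (file_diagonal (int r) (int s) k)) ks x"
  defines "V \<equiv> \<lambda>k i j. if R k (int i - int j) then mat_of y i j else mat_of x i j"
  shows "int i - int j \<notin> set ks \<Longrightarrow> mat_of y i j = mat_of x i j"
    and "i < r \<Longrightarrow> j < s \<Longrightarrow> int i - int j \<in> set ks \<Longrightarrow>
      mat_of y i j = upm r s (V (int i - int j)) i j + dnm (V (int i - int j)) i j - mat_of x i j"
proof -
  define f where "f k = rho (int r) (int s) (file_diagonal (int r) (int s) k)" for k
  define W where "W y k i j = (if R k (int i - int j) then mat_of y i j else mat_of x i j)" for y k i j
  have "(\<forall>i j. int i - int j \<notin> set ks \<longrightarrow> mat_of (foldr f ks x) i j = mat_of x i j) \<and>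
    (\<forall>i j. i < r \<longrightarrow> j < s \<longrightarrow> int i - int j \<in> set ks \<longrightarrow>
      mat_of (foldr f ks x) i j = upm r s (W (foldr f ks x) (int i - int j)) i j
        + dnm (W (foldr f ks x) (int i - int j)) i j - mat_of x i j)"
    using assms(1)
  proof (induction ks)
    case (Cons a ks)
    define y' where "y' = foldr f ks x"
    define y where "y = f a y'"
    have y: "foldr f (a # ks) x = y" by (simp add: y_def y'_def)
    have R: "\<And>k. k \<in> set ks \<Longrightarrow> R a k" and s: "sorted_wrt R ks" using Cons.prems by auto
    note IH = Cons.IH[OF s, folded y'_def]
    note out = IH[THEN conjunct1, rule_format]
    have a: "a \<notin> set ks" using R asym by blast
    have off: "mat_of y i j = mat_of y' i j" if "int i - int j \<noteq> a" for i j
      unfolding mat_of_def y_def f_def using that by (intro rho_outside) auto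
    have "mat_of y i j = upm r s (W y (int i - int j)) i j + dnm (W y (int i - int j)) i j - mat_of x i j"
      if ij: "i < r" "j < s" "int i - int j \<in> set (a # ks)" for i j
    proof (cases "int i - int j = a")
      case True
      have "mat_of y i j = upm r s (mat_of y) i j + dnm (mat_of y') i j - mat_of y' i j"
        unfolding y_def f_def by (rule rho_inside) (use True ij in auto)
      moreover have "mat_of y i' j' = W y a i' j'" "mat_of y' i' j' = W y a i' j'"
        if "int i' - int j' \<noteq> int i - int j" for i' j'
        using that off[of i' j'] out[of i' j'] R True by (auto simp: W_def)
      then have "upm r s (mat_of y) i j = upm r s (W y a) i j" "dnm (mat_of y') i j = dnm (W y a) i j"
        by (intro upm_dnm_cong; simp)+
      ultimately show ?thesis using out[of i j] a True by simp
    next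
      case False
      then have k: "int i - int j \<in> set ks" using ij by simp
      have "W y' (int i - int j) i' j' = W y (int i - int j) i' j'" for i' j'
        unfolding W_def using off[of i' j'] R[OF k] asym by metis
      then have "W y' (int i - int j) = W y (int i - int j)" by blast
      then show ?thesis
        using IH[THEN conjunct2, rule_format, OF ij(1,2) k] off[OF False] by simp
    qed
    moreover have "mat_of y i j = mat_of x i j" if "int i - int j \<notin> set (a # ks)" for i j
      using that off[of i j] out[of i j] by simp
    ultimately show ?case unfolding y by blast
  qed simp
  then show "int i - int j \<notin> set ks \<Longrightarrow> mat_of y i j = mat_of x i j"
    and "i < r \<Longrightarrow> j < s \<Longrightarrow> int i - int j \<in> set ks \<Longrightarrow>
      mat_of y i j = upm r s (V (int i - int j)) i j + dnm (V (int i - int j)) i j - mat_of x i j"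
    unfolding y_def V_def W_def f_def by blast+
qed

text \<open>\<open>l + j < s\<close> says that the box is at most as far from the last row as from
  the last column, so that \<open>l\<close> is its layer in \<open>rskm\<close>.\<close>

lemma pr_rskm: "l < r \<Longrightarrow> l + j < s \<Longrightarrow> pr r X l j = rskm r s X (r - 1 - l) j"
  proof -
  assume "l < r" "l + j < s"
  then have "min (r - 1 - (r - 1 - l)) (s - 1 - j) = l" by auto
  then show ?thesis by (simp only: pr_def rskm_def)
qed

lemma pr_tr_rskm: "l < s \<Longrightarrow> l + i < r \<Longrightarrow> pr s (tr X) l i = rskm r s X i (s - 1 - l)"
  proof -
  assume "l < s" "l + i < r"
  then have "min (r - 1 - i) (s - 1 - (s - 1 - l)) = l" by auto
  then show ?thesis by (simp only: pr_def rskm_def nxt_funpow_tr lpp_tr)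
qed

lemma RSK_conj:
  assumes "z = (inv (RSK (int r) (int s)) \<circ> g \<circ> RSK (int r) (int s)) x"
  shows "RSK (int r) (int s) z = g (RSK (int r) (int s) x)"
  using assms bij_RSK by (simp add: bij_is_surj surj_f_inv_f)

text \<open>\<open>ProP\<close> toggles the diagonals with \<open>i - j > r - s\<close>, strictly on
  the side of the last row. There the toggles amount to \<open>promoted\<close>. The half with the
  last column, main diagonal included, is fixed, which gives the column equivalence.\<close>

lemma psi_ConjProP:
  fixes x :: labeling and r s :: nat
  defines "X \<equiv> mat_of x" and "Z \<equiv> mat_of (psi ConjProP (int r) (int s) x)"
  shows "row_eq r (s - 1) (shc 1 X) Z" "col_eq r s X Z"
proof -
  define u where "u = RSK (int r) (int s) x"
  define y where "y = ProP (int r) (int s) u"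
  define ks where "ks = [int r - int s + 1..int r - 1]"
  define V where "V k i j = (if k < int i - int j then mat_of y i j else mat_of u i j)" for k i j
  have "RSK (int r) (int s) (psi ConjProP (int r) (int s) x) = y"
    unfolding y_def u_def by (rule RSK_conj) simp
  then have Z: "mat_of y i j = rskm r s Z i j" if "i < r" "j < s" for i j
    using RSK_inside[OF that] unfolding Z_def by metis
  have X: "mat_of u i j = rskm r s X i j" if "i < r" "j < s" for i j
    using RSK_inside[OF that] unfolding X_def u_def by metis
  have sorted: "sorted_wrt (<) ks" by (simp add: ks_def)
  note F = foldr_rho_file_diagonals[OF sorted, where x = u and r = r and s = s,
      folded ks_def, folded ProP_def[of "int r" "int s", folded ks_def] y_def, folded V_def]
  have "promoted r s X Z"
    unfolding promoted_def
  proof (intro allI impI)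
    fix l j assume l: "l < r" "l + j < s - 1"
    define i where "i = r - 1 - l"
    have "int i - int j \<in> set ks" using l by (auto simp: ks_def i_def)
    then have eq: "mat_of y i j = upm r s (V (int i - int j)) i j + dnm (V (int i - int j)) i j - mat_of u i j"
      using F(2)[of i j] l by (simp add: i_def)
    \<comment> \<open>Larger diagonals are toggled earlier: the neighbours at
      \<open>(i + 1, j)\<close> and \<open>(i, j - 1)\<close> already have new labels, those at
      \<open>(i, j + 1)\<close> and \<open>(i - 1, j)\<close> still old ones.\<close>
    have up: "upm r s (V (int i - int j)) i j
      = (if l = 0 then mat_of u i (Suc j) else min (mat_of y (Suc i) j) (mat_of u i (Suc j)))"
      using l by (auto simp: upm_def V_def i_def)
    have dn: "dnm (V (int i - int j)) i j
      = (if Suc l < r then (if j = 0 then mat_of u (i - 1) 0 else max (mat_of u (i - 1) j) (mat_of y i (j - 1)))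
        else (if j = 0 then 0 else mat_of y i (j - 1)))"
      using l by (auto simp: dnm_def V_def i_def)
    have a: "mat_of y i j = pr r Z l j" "mat_of u i j = pr r X l j" "mat_of u i (Suc j) = pr r X l (Suc j)"
      using l by (simp_all add: Z X i_def pr_rskm[where s = s])
    have b: "mat_of y (Suc i) j = pr r Z (l - 1) j" if "l \<noteq> 0"
    proof -
      have "Suc i = r - 1 - (l - 1)" using that l i_def by auto
      then show ?thesis using l by (simp add: Z pr_rskm[where s = s])
    qed
    have c: "mat_of u (i - 1) j = pr r X (Suc l) j" if "Suc l < r"
      using l that by (simp add: X pr_rskm[where s = s] i_def)
    have d: "mat_of y i (j - 1) = pr r Z l (j - 1)"
      using l by (simp add: Z pr_rskm[where s = s] i_def)
    have up': "upm r s (V (int i - int j)) i j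
      = (if l = 0 then pr r X 0 (Suc j) else min (pr r Z (l - 1) j) (pr r X l (Suc j)))"
      unfolding up a using b by (cases "l = 0") (simp_all del: tr_apply)
    have dn': "dnm (V (int i - int j)) i j
      = (if Suc l < r then (if j = 0 then pr r X (Suc l) 0
            else max (pr r X (Suc l) j) (pr r Z l (j - 1)))
        else (if j = 0 then 0 else pr r Z l (j - 1)))"
      unfolding dn d using c by (cases "Suc l < r"; cases "j = 0") (simp_all del: tr_apply)
    show "pr r Z l j =
     (if l = 0 then pr r X 0 (Suc j) else min (pr r Z (l - 1) j) (pr r X l (Suc j)))
     + (if Suc l < r then (if j = 0 then pr r X (Suc l) 0
          else max (pr r X (Suc l) j) (pr r Z l (j - 1)))
        else (if j = 0 then 0 else pr r Z l (j - 1)))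
     - pr r X l j"
      using eq unfolding up' dn' a .
  qed
  then show "row_eq r (s - 1) (shc 1 X) Z" by (rule promoted_imp_row_eq)
  have "same_pr s r (tr X) (tr Z)"
    unfolding same_pr_def
  proof (intro allI impI)
    fix l i assume l: "l < s" "l + i < r"
    have "mat_of y i (s - 1 - l) = mat_of u i (s - 1 - l)"
      by (rule F(1)) (use l in \<open>auto simp: ks_def\<close>)
    then show "pr s (tr X) l i = pr s (tr Z) l i"
      using l by (simp add: Z X pr_tr_rskm del: tr_apply)
  qed
  then show "col_eq r s X Z"
    unfolding col_eq_def by (rule same_pr_imp_row_eq)
qed

lemma psi_ConjProQ:
  fixes x :: labeling and r s :: nat
  defines "X \<equiv> mat_of x" and "Z \<equiv> mat_of (psi ConjProQ (int r) (int s) x)"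
  shows "row_eq s (r - 1) (shc 1 (tr X)) (tr Z)" "row_eq r s X Z"
proof -
  define u where "u = RSK (int r) (int s) x"
  define y where "y = ProQ (int r) (int s) u"
  \<comment> \<open>\<open>ProQ\<close> is a \<open>fold\<close>; as a \<open>foldr\<close> it runs
    through the reversed list, and smaller diagonals are toggled earlier.\<close>
  define ks where "ks = rev [1 - int s..int r - int s - 1]"
  define V where "V k i j = (if k > int i - int j then mat_of y i j else mat_of u i j)" for k i j
  have "RSK (int r) (int s) (psi ConjProQ (int r) (int s) x) = y"
    unfolding y_def u_def by (rule RSK_conj) simp
  then have Z: "mat_of y i j = rskm r s Z i j" if "i < r" "j < s" for i j
    using RSK_inside[OF that] unfolding Z_def by metis
  have X: "mat_of u i j = rskm r s X i j" if "i < r" "j < s" for i j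
    using RSK_inside[OF that] unfolding X_def u_def by metis
  have sorted: "sorted_wrt (>) ks" by (simp add: ks_def sorted_wrt_rev)
  have ProQ: "ProQ (int r) (int s)
      = foldr (\<lambda>k. rho (int r) (int s) (file_diagonal (int r) (int s) k)) ks"
    by (simp only: ProQ_def ks_def foldr_conv_fold rev_rev_ident)
  have set: "set ks = {1 - int s..int r - int s - 1}" by (simp add: ks_def)
  note F = foldr_rho_file_diagonals[OF sorted, where x = u and r = r and s = s,
      folded ProQ y_def, folded V_def]
  have "promoted s r (tr X) (tr Z)"
    unfolding promoted_def
  proof (intro allI impI)
    fix l i assume l: "l < s" "l + i < r - 1"
    define j where "j = s - 1 - l"
    have "int i - int j \<in> set ks" using l by (auto simp: set j_def)
    then have eq: "mat_of y i j = upm r s (V (int i - int j)) i j + dnm (V (int i - int j)) i j - mat_of u i j"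
      using F(2)[of i j] l by (simp add: j_def)
    have up: "upm r s (V (int i - int j)) i j
      = (if l = 0 then mat_of u (Suc i) j else min (mat_of y i (Suc j)) (mat_of u (Suc i) j))"
      using l by (auto simp: upm_def V_def j_def)
    have dn: "dnm (V (int i - int j)) i j
      = (if Suc l < s then (if i = 0 then mat_of u 0 (j - 1) else max (mat_of u i (j - 1)) (mat_of y (i - 1) j))
        else (if i = 0 then 0 else mat_of y (i - 1) j))"
      using l by (auto simp: dnm_def V_def j_def max.commute)
    have a: "mat_of y i j = pr s (tr Z) l i" "mat_of u i j = pr s (tr X) l i"
      "mat_of u (Suc i) j = pr s (tr X) l (Suc i)"
      using l by (simp_all add: Z X j_def pr_tr_rskm[where r = r] del: tr_apply)
    have b: "mat_of y i (Suc j) = pr s (tr Z) (l - 1) i" if "l \<noteq> 0"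
    proof -
      have "Suc j = s - 1 - (l - 1)" using that l j_def by auto
      then show ?thesis using l by (simp add: Z pr_tr_rskm[where r = r] del: tr_apply)
    qed
    have c: "mat_of u i (j - 1) = pr s (tr X) (Suc l) i" if "Suc l < s"
      using l that by (simp add: X pr_tr_rskm[where r = r] j_def del: tr_apply)
    have d: "mat_of y (i - 1) j = pr s (tr Z) l (i - 1)"
      using l by (simp add: Z pr_tr_rskm[where r = r] j_def del: tr_apply)
    have up': "upm r s (V (int i - int j)) i j
      = (if l = 0 then pr s (tr X) 0 (Suc i) else min (pr s (tr Z) (l - 1) i) (pr s (tr X) l (Suc i)))"
      unfolding up a using b by (cases "l = 0") (simp_all del: tr_apply)
    have dn': "dnm (V (int i - int j)) i j
      = (if Suc l < s then (if i = 0 then pr s (tr X) (Suc l) 0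
            else max (pr s (tr X) (Suc l) i) (pr s (tr Z) l (i - 1)))
        else (if i = 0 then 0 else pr s (tr Z) l (i - 1)))"
      unfolding dn d using c by (cases "Suc l < s"; cases "i = 0") (simp_all del: tr_apply)
    show "pr s (tr Z) l i =
     (if l = 0 then pr s (tr X) 0 (Suc i) else min (pr s (tr Z) (l - 1) i) (pr s (tr X) l (Suc i)))
     + (if Suc l < s then (if i = 0 then pr s (tr X) (Suc l) 0
          else max (pr s (tr X) (Suc l) i) (pr s (tr Z) l (i - 1)))
        else (if i = 0 then 0 else pr s (tr Z) l (i - 1)))
     - pr s (tr X) l i"
      using eq unfolding up' dn' a .
  qed
  then show "row_eq s (r - 1) (shc 1 (tr X)) (tr Z)" by (rule promoted_imp_row_eq)
  have "same_pr r s X Z"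
    unfolding same_pr_def
  proof (intro allI impI)
    fix l j assume l: "l < r" "l + j < s"
    have "mat_of y (r - 1 - l) j = mat_of u (r - 1 - l) j"
      by (rule F(1)) (use l in \<open>auto simp: set\<close>)
    then show "pr r X l j = pr r Z l j"
      using l by (simp add: Z X pr_rskm[where s = s])
  qed
  then show "row_eq r s X Z" by (rule same_pr_imp_row_eq)
qed

section \<open>The three maps as maps of matrices\<close>

fun shift_i shift_j :: "kind \<Rightarrow> nat" where
  "shift_i ConjProP = 0" | "shift_i ConjProQ = 1" | "shift_i ConjRowInv = 1"
| "shift_j ConjProP = 1" | "shift_j ConjProQ = 0" | "shift_j ConjRowInv = 1"

lemma promotion_cong:
  assumes "row_eq r (s - 1) (shc 1 x) y" "col_eq r s x y" "row_eq r (s - 1) (shc 1 x') y'"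
    "col_eq r s x' y'" "agree r s x x'"
  shows "agree r s y y'"
proof (rule row_col_eq_unique_diagonal)
  have "agree r (s - 1) (shc 1 x) (shc 1 x')"
    using assms(5) by (simp add: agree_def)
  then show "row_eq r (s - 1) y y'" using assms(1,3) by (meson row_eq.intros)
  have "col_eq r s x x'"
    using assms(5) by (simp add: col_eq_def agree_tr row_eq.agree del: tr_apply)
  then show "col_eq r s y y'" using assms(2,4) unfolding col_eq_def by (meson row_eq.intros)
qed

text \<open>For the promotions this follows from uniqueness, without inspecting toggles or the
  inverse of RSK; for rowmotion the closed form shows it.\<close>

lemma psi_cong:
  assumes "agree r s (mat_of x) (mat_of x')"
  shows "agree r s (mat_of (psi k (int r) (int s) x)) (mat_of (psi k (int r) (int s) x'))"
proof (cases k)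
  case ConjProP
  show ?thesis unfolding ConjProP using psi_ConjProP psi_ConjProP assms by (rule promotion_cong)
next
  case ConjProQ
  have col: "col_eq s r (tr (mat_of x)) (tr (mat_of (psi ConjProQ (int r) (int s) x)))" for x
    using psi_ConjProQ(2) by (simp only: col_eq_tr)
  have "agree s r (tr (mat_of (psi k (int r) (int s) x))) (tr (mat_of (psi k (int r) (int s) x')))"
    unfolding ConjProQ using psi_ConjProQ(1) col psi_ConjProQ(1) col agree_tr[THEN iffD2, OF assms]
    by (rule promotion_cong)
  then show ?thesis by (simp only: agree_tr)
next
  case ConjRowInv
  then show ?thesis
    using inv_row_cong[OF assms] by (simp add: agree_def psi_ConjRowInv del: psi.simps)
qed

definition mpsi :: "kind \<Rightarrow> nat \<Rightarrow> nat \<Rightarrow> mat \<Rightarrow> mat" where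
  "mpsi k r s X = mat_of (psi k (int r) (int s) (lab_of X))"

lemma psi_inside: "i < r \<Longrightarrow> j < s \<Longrightarrow> psi k (int r) (int s) x (bx i j) = mpsi k r s (mat_of x) i j"
  using psi_cong[of r s x "lab_of (mat_of x)" k] by (simp add: agree_def mpsi_def mat_of_def[of "psi _ _ _ _"])

lemma psi_ok_cong:
  assumes G: "psi_ok r s di dj G" and FG: "\<And>x. agree r s (F x) (G x)"
  shows "psi_ok r s di dj F"
proof -
  note G = G[unfolded psi_ok_def]
  note FG' = FG[THEN agree_sym]
  have "agree r s (F x) (F z)" if "agree r s x z" for x z
    using G that by (meson agree_trans FG FG')
  moreover have "row_eq r (s - dj) (shc dj x) (F x)" for x
    using G row_eq.agree[OF agree_mono[OF FG' order_refl diff_le_self]] by (meson row_eq.trans)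
  moreover have "col_eq (r - di) s (shr di x) (F x)" for x
    using G row_eq.agree[OF agree_tr[THEN iffD2, OF agree_mono[OF FG' diff_le_self order_refl]]]
    unfolding col_eq_def by (meson row_eq.trans)
  moreover have "agree r s (F (rowop (di + i) th x)) (rowop i th (F x))" if "Suc (di + i) < r" for x i th
  proof -
    have "agree r s (rowop i th (G x)) (rowop i th (F x))"
      by (rule agree_rowop[OF FG']) (use that in simp)
    then show ?thesis using G that by (meson agree_trans FG)
  qed
  moreover have "agree r s (F (colop (dj + j) th x)) (colop j th (F x))" if "Suc (dj + j) < s" for x j th
  proof -
    have "agree s r (rowop j th (tr (G x))) (rowop j th (tr (F x)))"
      by (rule agree_rowop[OF agree_tr[THEN iffD2, OF FG']]) (use that in simp)
    then have "agree r s (colop j th (G x)) (colop j th (F x))"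
      unfolding colop_def agree_tr .
    then show ?thesis using G that by (meson agree_trans FG)
  qed
  ultimately show ?thesis unfolding psi_ok_def by blast
qed

lemma psi_ok_mpsi: "psi_ok r s (shift_i k) (shift_j k) (mpsi k r s)"
proof (cases k)
  case ConjProP
  have "psi_ok r s 0 1 (mpsi ConjProP r s)"
  proof (rule psi_ok_promotion)
    fix x z assume "agree r s x z"
    then show "agree r s (mpsi ConjProP r s x) (mpsi ConjProP r s z)"
      unfolding mpsi_def by (intro psi_cong) simp
  qed (use psi_ConjProP[of r s "lab_of _"] in \<open>simp_all only: mpsi_def mat_of_lab_of\<close>)
  then show ?thesis by (simp add: ConjProP)
next
  case ConjProQ
  have "psi_ok s r 0 1 (\<lambda>x. tr (mpsi ConjProQ r s (tr x)))"
  proof (rule psi_ok_promotion)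
    fix x z assume "agree s r x z"
    then have "agree r s (tr x) (tr z)" by (simp only: agree_tr)
    then have "agree r s (mpsi ConjProQ r s (tr x)) (mpsi ConjProQ r s (tr z))"
      unfolding mpsi_def by (intro psi_cong) (simp only: mat_of_lab_of)
    then show "agree s r (tr (mpsi ConjProQ r s (tr x))) (tr (mpsi ConjProQ r s (tr z)))"
      by (simp only: agree_tr)
  next
    fix x
    show "row_eq s (r - 1) (shc 1 x) (tr (mpsi ConjProQ r s (tr x)))"
      using psi_ConjProQ(1)[of s r "lab_of (tr x)"] by (simp only: mpsi_def mat_of_lab_of tr_tr)
    show "col_eq s r x (tr (mpsi ConjProQ r s (tr x)))"
      using psi_ConjProQ(2)[of r s "lab_of (tr x)"] unfolding col_eq_def
      by (simp only: mpsi_def mat_of_lab_of tr_tr)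
  qed
  from psi_ok_tr[OF this] show ?thesis unfolding tr_tr by (simp add: ConjProQ)
next
  case ConjRowInv
  have "agree r s (mpsi k r s x) (inv_row r s x)" for x
    by (simp add: agree_def mpsi_def psi_ConjRowInv ConjRowInv del: psi.simps)
  then have "psi_ok r s 1 1 (mpsi k r s)" by (rule psi_ok_cong[OF psi_ok_inv_row])
  then show ?thesis by (simp add: ConjRowInv)
qed

section \<open>Maximal rectangles of moon polyominoes\<close>

lemma mem_boxes: "(i, j) \<in> boxes R \<longleftrightarrow> imin R \<le> i \<and> i \<le> imax R \<and> jmin R \<le> j \<and> j \<le> jmax R"
  by (auto simp: boxes_def)

definition in_rows :: "rect \<Rightarrow> int \<Rightarrow> bool" where
  "in_rows R i \<longleftrightarrow> imin R \<le> i \<and> i \<le> imax R"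

definition in_cols :: "rect \<Rightarrow> int \<Rightarrow> bool" where
  "in_cols R j \<longleftrightarrow> jmin R \<le> j \<and> j \<le> jmax R"

lemma mem_boxes_iff: "(i, j) \<in> boxes R \<longleftrightarrow> in_rows R i \<and> in_cols R j"
  by (auto simp: boxes_def in_rows_def in_cols_def)

lemma type_D_iff: "type_D R (i, j) \<longleftrightarrow> \<not> in_rows R i \<and> in_cols R j"
  by (auto simp: type_D_def in_rows_def in_cols_def)

lemma type_U_iff: "type_U R (i, j) \<longleftrightarrow> in_rows R i \<and> \<not> in_cols R j"
  by (auto simp: type_U_def in_rows_def in_cols_def)

lemma maximal_rect_iff:
  assumes "proper_rect R" "boxes R \<subseteq> M"
    and "\<And>i. \<forall>j. in_cols R j \<longrightarrow> (i, j) \<in> M \<Longrightarrow> in_rows R i"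
    and "\<And>j. \<forall>i. in_rows R i \<longrightarrow> (i, j) \<in> M \<Longrightarrow> in_cols R j"
  shows "maximal_rect M R"
  unfolding maximal_rect_def
proof (intro conjI allI impI)
  fix R' assume R': "proper_rect R' \<and> boxes R' \<subseteq> M \<and> boxes R \<subseteq> boxes R'"
  have pR: "imin R \<le> imax R" "jmin R \<le> jmax R" using assms(1) by (auto simp: proper_rect_def)
  have sub: "in_rows R i \<Longrightarrow> in_cols R j \<Longrightarrow> in_rows R' i \<and> in_cols R' j" for i j
    using R' subsetD[of "boxes R" "boxes R'" "(i, j)"] by (simp add: mem_boxes_iff)
  have cols: "in_cols R j \<Longrightarrow> in_cols R' j" and rows: "in_rows R i \<Longrightarrow> in_rows R' i" for i j
    using sub[of "imin R" j] sub[of i "jmin R"] pR by (auto simp: in_rows_def in_cols_def)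
  have M: "in_rows R' i \<Longrightarrow> in_cols R' j \<Longrightarrow> (i, j) \<in> M" for i j
    using R' subsetD[of "boxes R'" M "(i, j)"] by (simp add: mem_boxes_iff)
  have "boxes R' \<subseteq> boxes R"
  proof
    fix q assume "q \<in> boxes R'"
    then obtain i j where q: "q = (i, j)" "in_rows R' i" "in_cols R' j"
      by (cases q) (auto simp: mem_boxes_iff)
    have "in_rows R i" using assms(3)[of i] M cols q by blast
    moreover have "in_cols R j" using assms(4)[of j] M rows q by blast
    ultimately show "q \<in> boxes R" using q by (simp add: mem_boxes_iff)
  qed
  then show "boxes R' = boxes R" using R' by blast
qed (use assms in auto)

lemma moon_col_convex:
  assumes "moon_polyomino M" "(i1, j) \<in> M" "(i2, j) \<in> M" "i1 \<le> i" "i \<le> i2"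
  shows "(i, j) \<in> M"
proof -
  have "int_interval (down_diagonal M j)"
    using assms(1) by (simp add: moon_polyomino_def convex_polyomino_def)
  then show ?thesis
    using assms(2-) unfolding int_interval_def down_diagonal_def by fastforce
qed

lemma moon_row_convex:
  assumes "moon_polyomino M" "(i, j1) \<in> M" "(i, j2) \<in> M" "j1 \<le> j" "j \<le> j2"
  shows "(i, j) \<in> M"
proof -
  have "int_interval (up_diagonal M i)"
    using assms(1) by (simp add: moon_polyomino_def convex_polyomino_def)
  then show ?thesis
    using assms(2-) unfolding int_interval_def up_diagonal_def by fastforce
qed

lemma moon_crossing:
  assumes "moon_polyomino M" "(i1, j1) \<in> M" "(i2, j2) \<in> M"
  shows "(i1, j2) \<in> M \<or> (i2, j1) \<in> M"
proof -
  have "up_diagonal M i1 \<subseteq> up_diagonal M i2 \<or> up_diagonal M i2 \<subseteq> up_diagonal M i1"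
    using assms(1) by (simp add: moon_polyomino_def intersection_free_def)
  then show ?thesis using assms(2,3) by (auto simp: up_diagonal_def)
qed

locale maximal_in_moon =
  fixes M :: "box set" and R :: rect
  assumes moon: "moon_polyomino M" and max: "maximal_rect M R"
begin

lemma proper: "imin R \<le> imax R" "jmin R \<le> jmax R"
  using max by (auto simp: maximal_rect_def proper_rect_def)

lemma inside: "in_rows R i \<Longrightarrow> in_cols R j \<Longrightarrow> (i, j) \<in> M"
  using max by (auto simp: maximal_rect_def mem_boxes_iff)

lemma no_larger:
  assumes "imin R' \<le> imin R" "imax R \<le> imax R'" "jmin R' \<le> jmin R" "jmax R \<le> jmax R'"
    and "\<And>i j. in_rows R' i \<Longrightarrow> in_cols R' j \<Longrightarrow> (i, j) \<in> M"
  shows "R' = R"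
proof -
  have p: "proper_rect R'" using assms proper by (auto simp: proper_rect_def)
  moreover have "boxes R' \<subseteq> M" using assms(5) by (auto simp: mem_boxes_iff)
  moreover have "boxes R \<subseteq> boxes R'" using assms by (auto simp: mem_boxes)
  ultimately have eq: "boxes R' = boxes R" using max by (auto simp: maximal_rect_def)
  have "(imin R', jmin R') \<in> boxes R" "(imax R', jmax R') \<in> boxes R"
    unfolding eq[symmetric] using p by (auto simp: mem_boxes proper_rect_def)
  then show ?thesis using assms by (cases R; cases R') (auto simp: mem_boxes)
qed

text \<open>Convexity fills the rows between \<open>i\<close> and \<open>R\<close>, so a full row
  outside would enlarge \<open>R\<close>.\<close>

lemma full_row:
  assumes "\<And>j. in_cols R j \<Longrightarrow> (i, j) \<in> M"
  shows "in_rows R i"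
proof (rule ccontr)
  assume "\<not> in_rows R i"
  then consider "i < imin R" | "imax R < i" by (auto simp: in_rows_def)
  then show False
  proof cases
    case 1
    let ?R = "Rect i (imax R) (jmin R) (jmax R)"
    have "?R = R"
    proof (rule no_larger)
      fix i' j assume "in_rows ?R i'" "in_cols ?R j"
      then have *: "i \<le> i'" "i' \<le> imax R" "in_cols R j" by (auto simp: in_rows_def in_cols_def)
      show "(i', j) \<in> M"
        by (rule moon_col_convex[OF moon assms[OF *(3)] inside[of "imax R" j]])
          (use * proper in \<open>auto simp: in_rows_def\<close>)
    qed (use 1 in auto)
    then show False using 1 by (cases R) auto
  next
    case 2
    let ?R = "Rect (imin R) i (jmin R) (jmax R)"
    have "?R = R"
    proof (rule no_larger)
      fix i' j assume "in_rows ?R i'" "in_cols ?R j"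
      then have *: "imin R \<le> i'" "i' \<le> i" "in_cols R j" by (auto simp: in_rows_def in_cols_def)
      show "(i', j) \<in> M"
        by (rule moon_col_convex[OF moon inside[of "imin R" j] assms[OF *(3)]])
          (use * proper in \<open>auto simp: in_rows_def\<close>)
    qed (use 2 in auto)
    then show False using 2 by (cases R) auto
  qed
qed

lemma full_col:
  assumes "\<And>i. in_rows R i \<Longrightarrow> (i, j) \<in> M"
  shows "in_cols R j"
proof (rule ccontr)
  assume "\<not> in_cols R j"
  then consider "j < jmin R" | "jmax R < j" by (auto simp: in_cols_def)
  then show False
  proof cases
    case 1
    let ?R = "Rect (imin R) (imax R) j (jmax R)"
    have "?R = R"
    proof (rule no_larger)
      fix i j' assume "in_rows ?R i" "in_cols ?R j'"
      then have *: "j \<le> j'" "j' \<le> jmax R" "in_rows R i" by (auto simp: in_rows_def in_cols_def)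
      show "(i, j') \<in> M"
        by (rule moon_row_convex[OF moon assms[OF *(3)] inside[of i "jmax R"]])
          (use * proper in \<open>auto simp: in_cols_def\<close>)
    qed (use 1 in auto)
    then show False using 1 by (cases R) auto
  next
    case 2
    let ?R = "Rect (imin R) (imax R) (jmin R) j"
    have "?R = R"
    proof (rule no_larger)
      fix i j' assume "in_rows ?R i" "in_cols ?R j'"
      then have *: "jmin R \<le> j'" "j' \<le> j" "in_rows R i" by (auto simp: in_rows_def in_cols_def)
      show "(i, j') \<in> M"
        by (rule moon_row_convex[OF moon inside[of i "jmin R"] assms[OF *(3)]])
          (use * proper in \<open>auto simp: in_cols_def\<close>)
    qed (use 2 in auto)
    then show False using 2 by (cases R) auto
  qed
qed

text \<open>Otherwise maximality gives a gap in row \<open>i\<close> over the columns of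
  \<open>R\<close> and a gap in column \<open>j\<close> over its rows. With the box of
  \<open>R\<close> at the opposite corner this violates \<open>moon_crossing\<close>.\<close>

lemma meets:
  assumes "(i, j) \<in> M"
  shows "in_rows R i \<or> in_cols R j"
proof (rule ccontr)
  assume "\<not> ?thesis"
  then obtain j' i' where "in_cols R j'" "(i, j') \<notin> M" "in_rows R i'" "(i', j) \<notin> M"
    using full_row full_col by blast
  then show False using moon_crossing[OF moon assms inside[of i' j']] by blast
qed

end

text \<open>The first argument is the wide rectangle, the second the tall one.\<close>

definition crosses :: "rect \<Rightarrow> rect \<Rightarrow> bool" where
  "crosses R1 R2 \<longleftrightarrow> (\<forall>i. in_rows R1 i \<longrightarrow> in_rows R2 i) \<and> (\<exists>i. in_rows R2 i \<and> \<not> in_rows R1 i) \<and>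
     (\<forall>j. in_cols R2 j \<longrightarrow> in_cols R1 j) \<and> (\<exists>j. in_cols R1 j \<and> \<not> in_cols R2 j)"

text \<open>\<open>moon_crossing\<close> makes the column ranges comparable. Rows of the wider
  rectangle are then full over the narrower one, hence among its rows; equality in either direction
  would make one rectangle contain the other.\<close>

lemma maximal_rects_cross:
  assumes "moon_polyomino M" "maximal_rect M R1" "maximal_rect M R2" "R1 \<noteq> R2"
  shows "crosses R1 R2 \<or> crosses R2 R1"
proof -
  interpret m1: maximal_in_moon M R1 by standard (use assms in auto)
  interpret m2: maximal_in_moon M R2 by standard (use assms in auto)
  have cmp: "(\<forall>j. in_cols R2 j \<longrightarrow> in_cols R1 j) \<or> (\<forall>j. in_cols R1 j \<longrightarrow> in_cols R2 j)"
  proof (rule ccontr)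
    assume "\<not> ?thesis"
    then obtain j1 j2 where j: "in_cols R1 j1" "\<not> in_cols R2 j1" "in_cols R2 j2" "\<not> in_cols R1 j2" by blast
    then obtain i1 i2 where "in_rows R1 i1" "(i1, j2) \<notin> M" "in_rows R2 i2" "(i2, j1) \<notin> M"
      using m1.full_col m2.full_col by blast
    then show False using moon_crossing[OF assms(1) m1.inside[of i1 j1] m2.inside[of i2 j2]] j by blast
  qed
  have *: "crosses R R'"
    if "maximal_in_moon M R" "maximal_in_moon M R'" "R \<noteq> R'" "\<forall>j. in_cols R' j \<longrightarrow> in_cols R j" for R R'
  proof -
    interpret m: maximal_in_moon M R by fact
    interpret m': maximal_in_moon M R' by fact
    have rows: "in_rows R i \<Longrightarrow> in_rows R' i" for i
      using that(4) m'.full_row m.inside by blast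
    have le: "imin R' \<le> imin R" "imax R \<le> imax R'" "jmin R \<le> jmin R'" "jmax R' \<le> jmax R"
      using rows[of "imin R"] rows[of "imax R"] that(4)[rule_format, of "jmin R'"]
        that(4)[rule_format, of "jmax R'"] m.proper m'.proper by (auto simp: in_rows_def in_cols_def)
    have "\<exists>i. in_rows R' i \<and> \<not> in_rows R i"
    proof (rule ccontr)
      assume "\<not> ?thesis"
      then have "R = R'"
        by (intro m'.no_larger) (use m'.proper le m.inside in \<open>auto simp: in_rows_def\<close>)
      then show False using that by blast
    qed
    moreover have "\<exists>j. in_cols R j \<and> \<not> in_cols R' j"
    proof (rule ccontr)
      assume "\<not> ?thesis"
      then have "R' = R"
        by (intro m.no_larger) (use m.proper le m'.inside in \<open>auto simp: in_cols_def\<close>)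
      then show False using that by blast
    qed
    ultimately show ?thesis using rows that(4) by (auto simp: crosses_def)
  qed
  show ?thesis
    using cmp *[OF m1.maximal_in_moon_axioms m2.maximal_in_moon_axioms assms(4)]
      *[OF m2.maximal_in_moon_axioms m1.maximal_in_moon_axioms assms(4)[symmetric]] by blast
qed

lemma crosses_sizes: "crosses R1 R2 \<Longrightarrow> proper_rect R1 \<Longrightarrow> isize R1 < isize R2"
  unfolding crosses_def in_rows_def proper_rect_def isize_def
  by (smt (verit))

text \<open>Distinct maximal rectangles cross, and the wide one has fewer rows, so equal dimensions
  force equality.\<close>

lemma corresponding_rect_eq:
  assumes "moon_polyomino N" "maximal_rect N R'" "isize R' = isize R" "jsize R' = jsize R"
  shows "corresponding_rect N R = R'"
  unfolding corresponding_rect_def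
proof (rule the_equality)
  fix S assume S: "maximal_rect N S \<and> isize S = isize R \<and> jsize S = jsize R"
  show "S = R'"
  proof (rule ccontr)
    assume "S \<noteq> R'"
    then have "crosses S R' \<or> crosses R' S" using maximal_rects_cross assms S by blast
    then show False using crosses_sizes[of S R'] crosses_sizes[of R' S] S assms
      by (auto simp: maximal_rect_def)
  qed
qed (use assms in auto)

section \<open>Shape and labels after a single map\<close>

lemma move_box_eq:
  "move_box k R (i, j) =
     (if \<not> in_rows R i \<and> in_cols R j then (i, j - int (shift_j k))
      else if in_rows R i \<and> \<not> in_cols R j then (i - int (shift_i k), j) else (i, j))"
  by (cases k) (auto simp: move_box_def type_D_iff type_U_iff)

context maximal_in_moon
begin

lemma mem_act_shape:
  "(i, j) \<in> act_shape k R M \<longleftrightarrow> in_rows R i \<and> in_cols R j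
     \<or> (i, j + int (shift_j k)) \<in> M \<and> \<not> in_rows R i \<and> in_cols R (j + int (shift_j k))
     \<or> (i + int (shift_i k), j) \<in> M \<and> in_rows R (i + int (shift_i k)) \<and> \<not> in_cols R j"
  (is "?l \<longleftrightarrow> ?r")
proof
  assume ?l
  then obtain i' j' where p: "(i', j') \<in> M" "move_box k R (i', j') = (i, j)"
    by (auto simp: act_shape_def)
  then show ?r using meets[OF p(1)] by (auto simp: move_box_eq split: if_splits)
next
  assume ?r
  then obtain p where "p \<in> M" "move_box k R p = (i, j)"
    using inside
    by (elim disjE conjE) (fastforce simp: move_box_eq)+
  then show ?l unfolding act_shape_def by (metis imageI)
qed

text \<open>A type D box that moves into column \<open>jmax R\<close> would have to come from
  outside the columns of \<open>R\<close>, where there are no type D boxes. So no outer row becomes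
  full unless nothing moves; likewise for columns.\<close>

lemma maximal_act_shape: "maximal_rect (act_shape k R M) R"
proof (rule maximal_rect_iff)
  show "proper_rect R" using proper by (simp add: proper_rect_def)
  show "boxes R \<subseteq> act_shape k R M" by (auto simp: mem_boxes_iff mem_act_shape)
next
  fix i assume a: "\<forall>j. in_cols R j \<longrightarrow> (i, j) \<in> act_shape k R M"
  show "in_rows R i"
  proof (rule ccontr)
    assume i: "\<not> in_rows R i"
    have "in_cols R (jmax R)" using proper by (simp add: in_cols_def)
    then have "in_cols R (jmax R + int (shift_j k))" using a i by (auto simp: mem_act_shape)
    then have "shift_j k = 0" by (simp add: in_cols_def)
    then show False using full_row[of i] a i by (auto simp: mem_act_shape)
  qed
next
  fix j assume a: "\<forall>i. in_rows R i \<longrightarrow> (i, j) \<in> act_shape k R M"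
  show "in_cols R j"
  proof (rule ccontr)
    assume j: "\<not> in_cols R j"
    have "in_rows R (imax R)" using proper by (simp add: in_rows_def)
    then have "in_rows R (imax R + int (shift_i k))" using a j by (auto simp: mem_act_shape)
    then have "shift_i k = 0" by (simp add: in_rows_def)
    then show False using full_col[of j] a j by (auto simp: mem_act_shape)
  qed
qed

text \<open>In the new moon polyomino every box still meets \<open>R\<close>, so type D boxes cannot
  leave the columns of \<open>R\<close>, nor type U boxes its rows.\<close>

lemma mem_act_shape_moon:
  assumes "moon_polyomino (act_shape k R M)"
  shows "(i, j) \<in> act_shape k R M \<longleftrightarrow> in_rows R i \<and> in_cols R j
     \<or> \<not> in_rows R i \<and> in_cols R j \<and> in_cols R (j + int (shift_j k)) \<and> (i, j + int (shift_j k)) \<in> M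
     \<or> in_rows R i \<and> \<not> in_cols R j \<and> in_rows R (i + int (shift_i k)) \<and> (i + int (shift_i k), j) \<in> M"
proof -
  interpret N: maximal_in_moon "act_shape k R M" R
    by standard (use assms maximal_act_shape in auto)
  show ?thesis using mem_act_shape[of i j k] N.meets[of i j] by blast
qed

lemma act_labels_inside:
  "in_rows R i \<Longrightarrow> in_cols R j \<Longrightarrow> act_labels k R M x (i, j) = psi_on k R x (i, j)"
  by (simp add: act_labels_def mem_act_shape mem_boxes_iff)

lemma act_labels_outside: "q \<notin> act_shape k R M \<Longrightarrow> act_labels k R M x q = undefined"
  by (simp add: act_labels_def)

lemma act_labels_D:
  assumes "(i, j) \<in> act_shape k R M" "\<not> in_rows R i" "in_cols R j"
  shows "act_labels k R M x (i, j) = x (i, j + int (shift_j k))"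
proof -
  define p where "p = inv_into M (move_box k R) (i, j)"
  have "p \<in> M" "move_box k R p = (i, j)"
    using assms(1) by (simp_all add: act_shape_def p_def inv_into_into f_inv_into_f)
  then have "p = (i, j + int (shift_j k))"
    using assms(2,3) by (cases p) (auto simp: move_box_eq split: if_splits)
  then show ?thesis using assms by (simp add: act_labels_def mem_boxes_iff flip: p_def)
qed

lemma act_labels_U:
  assumes "(i, j) \<in> act_shape k R M" "in_rows R i" "\<not> in_cols R j"
  shows "act_labels k R M x (i, j) = x (i + int (shift_i k), j)"
proof -
  define p where "p = inv_into M (move_box k R) (i, j)"
  have "p \<in> M" "move_box k R p = (i, j)"
    using assms(1) by (simp_all add: act_shape_def p_def inv_into_into f_inv_into_f)
  then have "p = (i + int (shift_i k), j)"
    using assms(2,3) by (cases p) (auto simp: move_box_eq split: if_splits)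
  then show ?thesis using assms by (simp add: act_labels_def mem_boxes_iff flip: p_def)
qed

end

section \<open>Displacement of the other rectangle\<close>

definition shift_rect :: "int \<Rightarrow> int \<Rightarrow> rect \<Rightarrow> rect" where
  "shift_rect e d R = Rect (imin R - e) (imax R - e) (jmin R - d) (jmax R - d)"

lemma in_shift_rect [simp]:
  "in_rows (shift_rect e d R) i \<longleftrightarrow> in_rows R (i + e)"
  "in_cols (shift_rect e d R) j \<longleftrightarrow> in_cols R (j + d)"
  by (auto simp: shift_rect_def in_rows_def in_cols_def)

lemma size_shift_rect [simp]:
  "isize (shift_rect e d R) = isize R" "jsize (shift_rect e d R) = jsize R"
  by (simp_all add: shift_rect_def isize_def jsize_def)

lemma proper_shift_rect [simp]: "proper_rect (shift_rect e d R) \<longleftrightarrow> proper_rect R"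
  by (simp add: shift_rect_def proper_rect_def)

lemma crosses_act_wide:
  assumes "moon_polyomino M" "maximal_rect M R1" "maximal_rect M R2" "crosses R1 R2"
    and N: "moon_polyomino (act_shape k R1 M)"
  defines "R2' \<equiv> shift_rect 0 (int (shift_j k)) R2"
  shows "maximal_rect (act_shape k R1 M) R2'" and "in_cols R2' j \<Longrightarrow> in_cols R1 j"
    and "jmin R1 + int (shift_j k) \<le> jmin R2"
proof -
  interpret m1: maximal_in_moon M R1 by standard (use assms in auto)
  interpret m2: maximal_in_moon M R2 by standard (use assms in auto)
  interpret n: maximal_in_moon "act_shape k R1 M" R1
    by standard (use N m1.maximal_act_shape in auto)
  note cr = assms(4)[unfolded crosses_def]
  define d where "d = int (shift_j k)"
  obtain i0 where i0: "in_rows R2 i0" "\<not> in_rows R1 i0" using cr by blast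
  have p: "in_cols R2 (jmin R2)" "in_cols R2 (jmax R2)" using m2.proper by (auto simp: in_cols_def)
  then have "(i0, jmin R2 - d) \<in> act_shape k R1 M"
    using m1.mem_act_shape[of i0 "jmin R2 - d" k] i0 cr m2.inside by (auto simp: d_def)
  \<comment> \<open>Row \<open>i0\<close> of the tall rectangle lies outside \<open>R1\<close>, so
    its boxes really move; being in a moon polyomino they must still meet a column of
    \<open>R1\<close>. This bounds the displacement.\<close>
  then have "in_cols R1 (jmin R2 - d)" using n.meets i0 by blast
  then show le: "jmin R1 + int (shift_j k) \<le> jmin R2" by (simp add: in_cols_def d_def)
  have sub: "in_cols R1 j" if "in_cols R2 (j + d)" for j
    using le p cr that by (auto simp: in_cols_def d_def)
  then show "in_cols R2' j \<Longrightarrow> in_cols R1 j" by (simp add: R2'_def d_def)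
  note mem = m1.mem_act_shape_moon[OF N, folded d_def]
  show "maximal_rect (act_shape k R1 M) R2'"
  proof (rule maximal_rect_iff)
    show "proper_rect R2'" using m2.proper by (simp add: R2'_def proper_rect_def[of R2])
    have "(i, j) \<in> act_shape k R1 M" if "in_rows R2 i" "in_cols R2 (j + d)" for i j
      using that sub[of j] cr m2.inside by (auto simp: mem)
    then show "boxes R2' \<subseteq> act_shape k R1 M"
      by (auto simp: mem_boxes_iff R2'_def d_def)
  next
    fix i assume a: "\<forall>j. in_cols R2' j \<longrightarrow> (i, j) \<in> act_shape k R1 M"
    show "in_rows R2' i"
    proof (rule ccontr)
      assume "\<not> in_rows R2' i"
      then have i: "\<not> in_rows R2 i" "\<not> in_rows R1 i" using cr by (auto simp: R2'_def)
      have "(i, j) \<in> M" if "in_cols R2 j" for j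
        using a[rule_format, of "j - d"] that i by (auto simp: mem R2'_def d_def[symmetric])
      then show False using m2.full_row i by blast
    qed
  next
    fix j assume a: "\<forall>i. in_rows R2' i \<longrightarrow> (i, j) \<in> act_shape k R1 M"
    then have a': "(i, j) \<in> act_shape k R1 M" if "in_rows R2 i" for i
      using that by (simp add: R2'_def)
    have j: "in_cols R1 j" "in_cols R1 (j + d)" using a'[OF i0(1)] i0(2) by (auto simp: mem)
    have "(i, j + d) \<in> M" if "in_rows R2 i" for i
      using a'[OF that] j m1.inside by (auto simp: mem)
    then show "in_cols R2' j" using m2.full_col by (simp add: R2'_def d_def)
  qed
qed

lemma crosses_act_tall:
  assumes "moon_polyomino M" "maximal_rect M R1" "maximal_rect M R2" "crosses R1 R2"
    and N: "moon_polyomino (act_shape k R2 M)"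
  defines "R1' \<equiv> shift_rect (int (shift_i k)) 0 R1"
  shows "maximal_rect (act_shape k R2 M) R1'" and "in_rows R1' i \<Longrightarrow> in_rows R2 i"
    and "imin R2 + int (shift_i k) \<le> imin R1"
proof -
  interpret m1: maximal_in_moon M R1 by standard (use assms in auto)
  interpret m2: maximal_in_moon M R2 by standard (use assms in auto)
  interpret n: maximal_in_moon "act_shape k R2 M" R2
    by standard (use N m2.maximal_act_shape in auto)
  note cr = assms(4)[unfolded crosses_def]
  define e where "e = int (shift_i k)"
  obtain j0 where j0: "in_cols R1 j0" "\<not> in_cols R2 j0" using cr by blast
  have p: "in_rows R1 (imin R1)" "in_rows R1 (imax R1)" using m1.proper by (auto simp: in_rows_def)
  then have "(imin R1 - e, j0) \<in> act_shape k R2 M"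
    using m2.mem_act_shape[of "imin R1 - e" j0 k] j0 cr m1.inside by (auto simp: e_def)
  then have "in_rows R2 (imin R1 - e)" using n.meets j0 by blast
  then show le: "imin R2 + int (shift_i k) \<le> imin R1" by (simp add: in_rows_def e_def)
  have sub: "in_rows R2 i" if "in_rows R1 (i + e)" for i
    using le p cr that by (auto simp: in_rows_def e_def)
  then show "in_rows R1' i \<Longrightarrow> in_rows R2 i" by (simp add: R1'_def e_def)
  note mem = m2.mem_act_shape_moon[OF N, folded e_def]
  show "maximal_rect (act_shape k R2 M) R1'"
  proof (rule maximal_rect_iff)
    show "proper_rect R1'" using m1.proper by (simp add: R1'_def proper_rect_def[of R1])
    have "(i, j) \<in> act_shape k R2 M" if "in_rows R1 (i + e)" "in_cols R1 j" for i j
      using that sub[of i] cr m1.inside by (auto simp: mem)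
    then show "boxes R1' \<subseteq> act_shape k R2 M"
      by (auto simp: mem_boxes_iff R1'_def e_def)
  next
    fix j assume a: "\<forall>i. in_rows R1' i \<longrightarrow> (i, j) \<in> act_shape k R2 M"
    show "in_cols R1' j"
    proof (rule ccontr)
      assume "\<not> in_cols R1' j"
      then have j: "\<not> in_cols R1 j" "\<not> in_cols R2 j" using cr by (auto simp: R1'_def)
      have "(i, j) \<in> M" if "in_rows R1 i" for i
        using a[rule_format, of "i - e"] that j by (auto simp: mem R1'_def e_def[symmetric])
      then show False using m1.full_col j by blast
    qed
  next
    fix i assume a: "\<forall>j. in_cols R1' j \<longrightarrow> (i, j) \<in> act_shape k R2 M"
    then have a': "(i, j) \<in> act_shape k R2 M" if "in_cols R1 j" for j
      using that by (simp add: R1'_def)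
    have i: "in_rows R2 i" "in_rows R2 (i + e)" using a'[OF j0(1)] j0(2) by (auto simp: mem)
    have "(i + e, j) \<in> M" if "in_cols R1 j" for j
      using a'[OF that] i m2.inside by (auto simp: mem)
    then show "in_rows R1' i" using m1.full_row by (simp add: R1'_def e_def)
  qed
qed

definition mat_on :: "rect \<Rightarrow> labeling \<Rightarrow> mat" where
  "mat_on R x a b = x (imin R + int a, jmin R + int b)"

lemma psi_on_box:
  assumes "proper_rect R" "a < nat (isize R)" "b < nat (jsize R)"
  shows "psi_on k R x (imin R + int a, jmin R + int b)
    = mpsi k (nat (isize R)) (nat (jsize R)) (mat_on R x) a b"
proof -
  define y where "y = (\<lambda>(a, b). x (a + imin R - 1, b + jmin R - 1))"
  have "mat_of y = mat_on R x"
    by (intro ext) (simp add: y_def mat_of_def bx_def mat_on_def algebra_simps)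
  moreover have size: "int (nat (isize R)) = isize R" "int (nat (jsize R)) = jsize R"
    using assms(2,3) by auto
  moreover have "psi_on k R x (imin R + int a, jmin R + int b)
      = psi k (int (nat (isize R))) (int (nat (jsize R))) y (bx a b)"
    using assms(2,3) size by (simp add: psi_on_def y_def bx_def algebra_simps del: psi.simps)
  ultimately show ?thesis using psi_inside[OF assms(2,3)] by metis
qed

section \<open>Commutation\<close>

lemma crosses_commute:
  assumes M: "moon_polyomino M" "maximal_rect M R1" "maximal_rect M R2" and cr: "crosses R1 R2"
    and moon1: "moon_polyomino (act_shape k1 R1 M)" and moon2: "moon_polyomino (act_shape k2 R2 M)"
  defines "N1 \<equiv> act_shape k1 R1 M" and "N2 \<equiv> act_shape k2 R2 M"
    and "R2' \<equiv> shift_rect 0 (int (shift_j k1)) R2" and "R1' \<equiv> shift_rect (int (shift_i k2)) 0 R1"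
  assumes moon12: "moon_polyomino (act_shape k2 R2' N1)" and moon21: "moon_polyomino (act_shape k1 R1' N2)"
  shows "act_shape k2 R2' N1 = act_shape k1 R1' N2"
    and "act_labels k2 R2' N1 (act_labels k1 R1 M x) = act_labels k1 R1' N2 (act_labels k2 R2 M x)"
proof -
  define d1 e1 d2 e2 where d: "d1 = int (shift_j k1)" "e1 = int (shift_i k1)"
    "d2 = int (shift_j k2)" "e2 = int (shift_i k2)"
  note wide = crosses_act_wide[OF M cr moon1, folded N1_def R2'_def]
    and tall = crosses_act_tall[OF M cr moon2, folded N2_def R1'_def]
  interpret m1: maximal_in_moon M R1 by standard (use assms in auto)
  interpret m2: maximal_in_moon M R2 by standard (use assms in auto)
  interpret n1: maximal_in_moon N1 R2' by standard (use moon1 wide in \<open>auto simp: N1_def\<close>)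
  interpret n2: maximal_in_moon N2 R1' by standard (use moon2 tall in \<open>auto simp: N2_def\<close>)
  have R': "in_rows R2' i \<longleftrightarrow> in_rows R2 i" "in_cols R2' j \<longleftrightarrow> in_cols R2 (j + d1)"
    "in_rows R1' i \<longleftrightarrow> in_rows R1 (i + e2)" "in_cols R1' j \<longleftrightarrow> in_cols R1 j" for i j
    by (simp_all add: R1'_def R2'_def d)
  have c: "in_rows R1 i \<Longrightarrow> in_rows R2 i" "in_cols R2 j \<Longrightarrow> in_cols R1 j" for i j
    using cr by (auto simp: crosses_def)
  have s: "in_rows R1 (i + e2) \<Longrightarrow> in_rows R2 i" "in_cols R2 (j + d1) \<Longrightarrow> in_cols R1 j" for i j
    using wide(2) tall(2) by (auto simp: R')
  have s': "in_rows R1 (i + e2 + e1) \<Longrightarrow> in_rows R2 (i + e1)"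
    "in_cols R2 (j + d1 + d2) \<Longrightarrow> in_cols R1 (j + d2)" for i j
    using s(1)[of "i + e1"] s(2)[of "j + d2"] by (simp_all add: ac_simps)
  note mem1 = m1.mem_act_shape_moon[OF moon1, folded N1_def d]
    and mem2 = m2.mem_act_shape_moon[OF moon2, folded N2_def d]
    and mem12 = n1.mem_act_shape_moon[OF moon12, folded d, unfolded R']
    and mem21 = n2.mem_act_shape_moon[OF moon21, folded d, unfolded R']
  have comm: "i + e1 + e2 = i + e2 + e1" "i + d2 + d1 = i + d1 + d2" for i by simp_all
  \<comment> \<open>Both sides are unions of regions cut out by the rows and columns of the two
    displaced rectangles; \<open>s\<close> and \<open>s'\<close> keep these inside the larger
    ranges.\<close>
  have mem: "(i, j) \<in> act_shape k2 R2' N1 \<longleftrightarrow> (i, j) \<in> act_shape k1 R1' N2" for i j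
    unfolding mem12 mem21 mem1 mem2 comm
    by (cases "in_rows R1 (i + e2)"; cases "in_rows R2 i"; cases "in_cols R2 (j + d1)"; cases "in_cols R1 j")
      (auto simp: comm dest: c s s' intro: m1.inside m2.inside)
  then show shape: "act_shape k2 R2' N1 = act_shape k1 R1' N2" by auto

  define y1 y2 where y: "y1 = act_labels k1 R1 M x" "y2 = act_labels k2 R2 M x"
  note lab1 = m1.act_labels_inside[of _ _ k1 x, folded y] m1.act_labels_D[of _ _ k1 x, folded y N1_def d]
    m1.act_labels_U[of _ _ k1 x, folded y N1_def d]
  note lab2 = m2.act_labels_inside[of _ _ k2 x, folded y] m2.act_labels_D[of _ _ k2 x, folded y N2_def d]
    m2.act_labels_U[of _ _ k2 x, folded y N2_def d]
  note lab12 = n1.act_labels_inside[of _ _ k2 y1, unfolded R'] n1.act_labels_D[of _ _ k2 y1, folded d, unfolded R']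
    n1.act_labels_U[of _ _ k2 y1, folded d, unfolded R']
  note lab21 = n2.act_labels_inside[of _ _ k1 y2, unfolded R'] n2.act_labels_D[of _ _ k1 y2, folded d, unfolded R']
    n2.act_labels_U[of _ _ k1 y2, folded d, unfolded R']

  define r1 s1 r2 s2 where rs: "r1 = nat (isize R1)" "s1 = nat (jsize R1)"
    "r2 = nat (isize R2)" "s2 = nat (jsize R2)"
  define a b where ab: "a = nat (imin R1 - imin R2)" "b = nat (jmin R2 - jmin R1)"
  have p: "proper_rect R1" "proper_rect R2" "proper_rect R1'" "proper_rect R2'"
    using m1.proper m2.proper by (simp_all add: proper_rect_def R1'_def R2'_def shift_rect_def)
  have size: "int r1 = isize R1" "int s1 = jsize R1" "int r2 = isize R2" "int s2 = jsize R2"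
    using m1.proper m2.proper by (simp_all add: rs isize_def jsize_def)
  have "imax R1 \<le> imax R2" "imin R2 \<le> imin R1" "jmin R1 \<le> jmin R2" "jmax R2 \<le> jmax R1"
    using c(1)[of "imin R1"] c(1)[of "imax R1"] c(2)[of "jmin R2"] c(2)[of "jmax R2"] m1.proper m2.proper
    by (auto simp: in_rows_def in_cols_def)
  then have int_ab: "int a = imin R1 - imin R2" "int b = jmin R2 - jmin R1"
    and le: "a + r1 \<le> r2" "b + s2 \<le> s1"
    using size by (auto simp: ab isize_def jsize_def)
  have le': "shift_j k1 \<le> b" "shift_i k2 \<le> a"
    using wide(3) tall(3) int_ab by linarith+
  have int_ab': "int (b - shift_j k1) = jmin R2 - jmin R1 - d1" "int (a - shift_i k2) = imin R1 - imin R2 - e2"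
    using le' int_ab d by auto
  have rows: "in_rows R i \<longleftrightarrow> 0 \<le> i - imin R \<and> i - imin R < isize R"
    and cols: "in_cols R j \<longleftrightarrow> 0 \<le> j - jmin R \<and> j - jmin R < jsize R" for R i j
    by (auto simp: in_rows_def in_cols_def isize_def jsize_def)

  define F1 F2 x1 x2 where F: "F1 = mpsi k1 r1 s1" "F2 = mpsi k2 r2 s2"
    "x1 = mat_on R1 x" "x2 = mat_on R2 x"
  note ok1 = psi_ok_mpsi[of r1 s1 k1, folded F] and ok2 = psi_ok_mpsi[of r2 s2 k2, folded F]
  have psi1: "psi_on k1 R1 x (i, j) = F1 x1 u v"
    if "u < r1" "v < s1" "i = imin R1 + int u" "j = jmin R1 + int v" for i j u v
    using psi_on_box[OF p(1), of u v k1 x] that by (simp add: F rs)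
  have psi2: "psi_on k2 R2 x (i, j) = F2 x2 u v"
    if "u < r2" "v < s2" "i = imin R2 + int u" "j = jmin R2 + int v" for i j u v
    using psi_on_box[OF p(2), of u v k2 x] that by (simp add: F rs)

  define Y2 where "Y2 = ins a r1 x2 (shc (b - shift_j k1) (F1 x1))"
  define Y1 where "Y1 = tr (ins b s2 (tr x1) (tr (shr (a - shift_i k2) (F2 x2))))"
  \<comment> \<open>\<open>Y2\<close> holds the labels that the second map finds in the displaced
    tall rectangle: results of the first map in the rows of \<open>R1\<close>, old labels carried
    along by type D boxes elsewhere.\<close>
  have "agree r2 s2 (mat_on R2' y1) Y2"
    unfolding agree_def
  proof (intro allI impI)
    fix u v assume uv: "u < r2" "v < s2"
    define i j where ij: "i = imin R2 + int u" "j = jmin R2 - d1 + int v"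
    have i: "in_rows R2 i" using uv size by (simp add: rows ij)
    have j: "in_cols R2 (j + d1)" using uv size by (simp add: cols ij)
    have e: "mat_on R2' y1 u v = y1 (i, j)" by (simp add: mat_on_def R2'_def shift_rect_def ij d)
    show "mat_on R2' y1 u v = Y2 u v"
    proof (cases "a \<le> u \<and> u < a + r1")
      case True
      have "in_rows R1 i" using True int_ab size by (simp add: rows ij)
      then have "y1 (i, j) = psi_on k1 R1 x (i, j)" using s(2)[OF j] by (rule lab1)
      also have "\<dots> = F1 x1 (u - a) (b - shift_j k1 + v)"
        by (rule psi1) (use True le le' uv int_ab int_ab' in \<open>auto simp: ij\<close>)
      finally show ?thesis using True by (simp add: e Y2_def ins_def)
    next
      case False
      have "\<not> in_rows R1 i" using False int_ab size by (auto simp: rows ij)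
      moreover have "(i, j) \<in> N1" using j i by (intro n1.inside) (simp_all add: R')
      ultimately have "y1 (i, j) = x (i, j + d1)" using s(2)[OF j] by (intro lab1)
      also have "\<dots> = x2 u v" by (simp add: F mat_on_def ij)
      finally show ?thesis using False by (auto simp: e Y2_def ins_def)
    qed
  qed
  then have "agree r2 s2 (F2 (mat_on R2' y1)) (F2 Y2)"
    using ok2 by (simp add: psi_ok_def)
  then have psi12: "psi_on k2 R2' y1 (i, j) = F2 Y2 u v"
    if "u < r2" "v < s2" "i = imin R2 + int u" "j = jmin R2 - d1 + int v" for i j u v
    using psi_on_box[OF p(4), of u v k2 y1] that
    by (simp add: F rs agree_def R2'_def d) (simp add: shift_rect_def)

  have "agree r1 s1 (mat_on R1' y2) Y1"
    unfolding agree_def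
  proof (intro allI impI)
    fix u v assume uv: "u < r1" "v < s1"
    define i j where ij: "i = imin R1 - e2 + int u" "j = jmin R1 + int v"
    have j: "in_cols R1 j" using uv size by (simp add: cols ij)
    have i: "in_rows R1 (i + e2)" using uv size by (simp add: rows ij)
    have e: "mat_on R1' y2 u v = y2 (i, j)" by (simp add: mat_on_def R1'_def shift_rect_def ij d)
    show "mat_on R1' y2 u v = Y1 u v"
    proof (cases "b \<le> v \<and> v < b + s2")
      case True
      have "in_cols R2 j" using True int_ab size by (simp add: cols ij)
      then have "y2 (i, j) = psi_on k2 R2 x (i, j)" by (rule lab2(1)[OF s(1)[OF i]])
      also have "\<dots> = F2 x2 (a - shift_i k2 + u) (v - b)"
        by (rule psi2) (use True le le' uv int_ab int_ab' in \<open>auto simp: ij\<close>)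
      finally show ?thesis using True by (simp add: e Y1_def ins_def)
    next
      case False
      have "\<not> in_cols R2 j" using False int_ab size by (auto simp: cols ij)
      moreover have "(i, j) \<in> N2" using i j by (intro n2.inside) (simp_all add: R')
      ultimately have "y2 (i, j) = x (i + e2, j)" using s(1)[OF i] by (intro lab2)
      also have "\<dots> = x1 u v" by (simp add: F mat_on_def ij)
      finally show ?thesis using False by (auto simp: e Y1_def ins_def)
    qed
  qed
  then have "agree r1 s1 (F1 (mat_on R1' y2)) (F1 Y1)"
    using ok1 by (simp add: psi_ok_def)
  then have psi21: "psi_on k1 R1' y2 (i, j) = F1 Y1 u v"
    if "u < r1" "v < s1" "i = imin R1 - e2 + int u" "j = jmin R1 + int v" for i j u v
    using psi_on_box[OF p(3), of u v k1 y2] that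
    by (simp add: F rs agree_def R1'_def d) (simp add: shift_rect_def)

  have "x1 u (b + v) = x2 (a + u) v" for u v
    using int_ab by (simp add: F mat_on_def)
  note cross = crossing[where ?x1.0 = x1 and ?x2.0 = x2, OF ok1 ok2 le le' this, folded Y1_def Y2_def]

  have "act_labels k2 R2' N1 y1 (i, j) = act_labels k1 R1' N2 y2 (i, j)" for i j
  proof (cases "(i, j) \<in> act_shape k2 R2' N1")
    case False
    then show ?thesis
      using n1.act_labels_outside n2.act_labels_outside shape by simp
  next
    case True
    then have T: "(i, j) \<in> act_shape k1 R1' N2" using shape by simp
    note T12 = True[unfolded mem12] and T21 = T[unfolded mem21]
    \<comment> \<open>Final positions: the crossing (1), the rest of the tall (2) and of the wide
      rectangle (3), boxes of type D for \<open>R1\<close> and type U for \<open>R2\<close> (4), and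
      boxes of type U (5) or type D (6) for both. In the last three cases the displacements add
      up.\<close>
    consider (1) "in_rows R1 (i + e2)" "in_cols R2 (j + d1)"
      | (2) "in_rows R2 i" "\<not> in_rows R1 (i + e2)" "in_cols R2 (j + d1)"
      | (3) "in_rows R1 (i + e2)" "in_cols R1 j" "\<not> in_cols R2 (j + d1)"
      | (4) "in_rows R2 i" "\<not> in_rows R1 (i + e2)" "in_cols R1 j" "\<not> in_cols R2 (j + d1)"
      | (5) "in_rows R1 (i + e2)" "\<not> in_cols R1 j"
      | (6) "\<not> in_rows R2 i" "in_cols R2 (j + d1)"
      using T12 T21 by blast
    then show ?thesis
    proof cases
      case 1
      define u v where uv: "u = nat (i + e2 - imin R1)" "v = nat (j + d1 - jmin R2)"
      have u: "u < r1" "i = imin R1 - e2 + int u" and v: "v < s2" "j = jmin R2 - d1 + int v"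
        using 1 size by (auto simp: uv rows cols)
      have "act_labels k2 R2' N1 y1 (i, j) = psi_on k2 R2' y1 (i, j)" using s(1)[OF 1(1)] 1(2) by (rule lab12)
      also have "\<dots> = F2 Y2 (a - shift_i k2 + u) v"
        by (rule psi12) (use u v le le' int_ab' in auto)
      also have "\<dots> = F1 Y1 u (b - shift_j k1 + v)" using u(1) v(1) by (rule cross(3))
      also have "\<dots> = psi_on k1 R1' y2 (i, j)"
        by (rule psi21[symmetric]) (use u v le le' int_ab' in auto)
      also have "\<dots> = act_labels k1 R1' N2 y2 (i, j)" by (rule lab21(1)[symmetric, OF 1(1) s(2)[OF 1(2)]])
      finally show ?thesis .
    next
      case 2
      define u v where uv: "u = nat (i - imin R2)" "v = nat (j + d1 - jmin R2)"
      have u: "u < r2" "i = imin R2 + int u" and v: "v < s2" "j = jmin R2 - d1 + int v"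
        using 2 size by (auto simp: uv rows cols)
      have "u < a - shift_i k2 \<or> a - shift_i k2 + r1 \<le> u"
        using 2(2) u(2) int_ab' size by (auto simp: rows)
      note * = cross(1)[OF u(1) v(1) this]
      have "act_labels k2 R2' N1 y1 (i, j) = psi_on k2 R2' y1 (i, j)" using 2(1,3) by (rule lab12)
      also have "\<dots> = F2 x2 u v"
        unfolding *[symmetric] by (rule psi12) (use u v in auto)
      also have "\<dots> = psi_on k2 R2 x (i, j + d1)"
        by (rule psi2[symmetric]) (use u v in auto)
      also have "\<dots> = y2 (i, j + d1)" by (rule lab2(1)[symmetric, OF 2(1,3)])
      also have "\<dots> = act_labels k1 R1' N2 y2 (i, j)" by (rule lab21(2)[symmetric, OF T 2(2) s(2)[OF 2(3)]])
      finally show ?thesis .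
    next
      case 3
      define u v where uv: "u = nat (i + e2 - imin R1)" "v = nat (j - jmin R1)"
      have u: "u < r1" "i = imin R1 - e2 + int u" and v: "v < s1" "j = jmin R1 + int v"
        using 3 size by (auto simp: uv rows cols)
      have "v < b - shift_j k1 \<or> b - shift_j k1 + s2 \<le> v"
        using 3(3) v(2) int_ab' size by (auto simp: cols)
      note * = cross(2)[OF u(1) v(1) this]
      have "act_labels k2 R2' N1 y1 (i, j) = y1 (i + e2, j)" by (rule lab12(3)[OF True s(1)[OF 3(1)] 3(3)])
      also have "\<dots> = psi_on k1 R1 x (i + e2, j)" using 3(1,2) by (rule lab1)
      also have "\<dots> = F1 x1 u v"
        by (rule psi1) (use u v in auto)
      also have "\<dots> = psi_on k1 R1' y2 (i, j)"
        unfolding *[symmetric] by (rule psi21[symmetric]) (use u v in auto)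
      also have "\<dots> = act_labels k1 R1' N2 y2 (i, j)" by (rule lab21(1)[symmetric, OF 3(1,2)])
      finally show ?thesis .
    next
      case 4
      have "act_labels k2 R2' N1 y1 (i, j) = y1 (i + e2, j)" by (rule lab12(3)[OF True 4(1,4)])
      also have "\<dots> = x (i + e2, j + d1)"
        by (rule lab1(2)) (use T12 4 in auto)
      also have "\<dots> = y2 (i, j + d1)"
        by (rule lab2(3)[symmetric]) (use T21 4 in auto)
      also have "\<dots> = act_labels k1 R1' N2 y2 (i, j)" by (rule lab21(2)[symmetric, OF T 4(2,3)])
      finally show ?thesis .
    next
      case 5
      then have n: "\<not> in_cols R2 (j + d1)" "\<not> in_cols R2 j" using s c by blast+
      have "act_labels k2 R2' N1 y1 (i, j) = y1 (i + e2, j)" by (rule lab12(3)[OF True s(1)[OF 5(1)] n(1)])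
      also have "\<dots> = x (i + e2 + e1, j)"
        by (rule lab1(3)) (use T12 5 n in auto)
      also have "\<dots> = x (i + e1 + e2, j)" by (simp add: comm)
      also have "\<dots> = y2 (i + e1, j)"
        by (rule lab2(3)[symmetric]) (use T21 5 n s(1)[of "i + e1"] in auto)
      also have "\<dots> = act_labels k1 R1' N2 y2 (i, j)" by (rule lab21(3)[symmetric, OF T 5])
      finally show ?thesis .
    next
      case 6
      then have n: "\<not> in_rows R1 (i + e2)" "\<not> in_rows R1 i" using s c by blast+
      have "act_labels k2 R2' N1 y1 (i, j) = y1 (i, j + d2)" by (rule lab12(2)[OF True 6])
      also have "\<dots> = x (i, j + d2 + d1)"
        by (rule lab1(2)) (use T12 6 n s(2)[of "j + d2"] in auto)
      also have "\<dots> = x (i, j + d1 + d2)" by (simp add: comm)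
      also have "\<dots> = y2 (i, j + d1)"
        by (rule lab2(2)[symmetric]) (use T21 6 n in auto)
      also have "\<dots> = act_labels k1 R1' N2 y2 (i, j)" by (rule lab21(2)[symmetric, OF T n(1) s(2)[OF 6(2)]])
      finally show ?thesis .
    qed
  qed
  then have "act_labels k2 R2' N1 y1 = act_labels k1 R1' N2 y2" by auto
  then show "act_labels k2 R2' N1 (act_labels k1 R1 M x) = act_labels k1 R1' N2 (act_labels k2 R2 M x)"
    by (simp only: y)
qed

theorem theorem5p11:
  fixes M :: "box set" and R1 R2 :: rect and k1 k2 :: kind
  assumes "moon_polyomino M"
    and "maximal_rect M R1" and "maximal_rect M R2" and "R1 \<noteq> R2"
    and "moon_polyomino (act_shape k1 R1 M)" and "moon_polyomino (act_shape k2 R2 M)"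
    and "moon_polyomino (comp_shape k1 R1 k2 R2 M)"
    and "moon_polyomino (comp_shape k2 R2 k1 R1 M)"
  shows "comp_shape k1 R1 k2 R2 M = comp_shape k2 R2 k1 R1 M \<and>
    (\<forall>x \<in> M \<rightarrow>\<^sub>E UNIV. comp_labels k1 R1 k2 R2 M x = comp_labels k2 R2 k1 R1 M x)"
proof -
  \<comment> \<open>\<open>R\<close> is the wide and \<open>S\<close> the tall rectangle. The claim
    is symmetric in the two maps, so each of the two possible crossings is an instance.\<close>
  have *: "comp_shape l S k R M = comp_shape k R l S M \<and>
      comp_labels l S k R M x = comp_labels k R l S M x"
    if "maximal_rect M R" "maximal_rect M S" "crosses R S"
      "moon_polyomino (act_shape k R M)" "moon_polyomino (act_shape l S M)"
      "moon_polyomino (comp_shape k R l S M)" "moon_polyomino (comp_shape l S k R M)" for R S k l x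
  proof -
    have S: "corresponding_rect (act_shape k R M) S = shift_rect 0 (int (shift_j k)) S"
      by (rule corresponding_rect_eq) (use that assms(1) in \<open>auto intro: crosses_act_wide\<close>)
    have R: "corresponding_rect (act_shape l S M) R = shift_rect (int (shift_i l)) 0 R"
      by (rule corresponding_rect_eq) (use that assms(1) in \<open>auto intro: crosses_act_tall\<close>)
    show ?thesis
      using crosses_commute[OF assms(1) that(1-5)] that(6,7)
      by (simp add: comp_shape_def comp_labels_def Let_def R S)
  qed
  show ?thesis
    using maximal_rects_cross[OF assms(1-4)] *[of R1 R2 k1 k2] *[of R2 R1 k2 k1] assms by auto
qed

end
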